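(* Let $\mu,a\in\mathbb{R}$ and $b>0$, and let $W$ be a real-valued random variable. Then $W$ follows the $\mathrm{AL}(\mu,a,b)$ distribution if and only if $$\mathbb{E}\bigg[\frac{b^2}{2}f''(W)+af'(W)-\big(f(W)-f(\mu)\big)\bigg]=0$$ for all functions $f:\mathbb{R}\rightarrow\mathbb{R}$ such that $f$ and $f'$ are locally absolutely continuous with $\mathbb{E}|f'(Z)|<\infty$ and $\mathbb{E}|f''(Z)|<\infty$, for $Z\sim\mathrm{AL}(\mu,a,b)$.
   Context: For $\mu,a\in\mathbb{R}$ and $b>0$, the asymmetric Laplace distribution $\mathrm{AL}(\mu,a,b)$ is the distribution on $\mathbb{R}$ with characteristic function $\mathbb{E}[\mathrm{e}^{\mathrm{i}tZ}]=\dfrac{\mathrm{e}^{\mathrm{i}\mu t}}{1+b^2t^2/2-\mathrm{i}at}$, $t\in\mathbb{R}$; equivalently, with density $$\frac{1}{\sqrt{2b^2+a^2}}\exp\bigg(\frac{a}{b^2}(x-\mu)-\frac{1}{b}\sqrt{2+\frac{a^2}{b^2}}\,|x-\mu|\bigg),\quad x\in\mathbb{R}.$$ *)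

theory Defs
  imports "HOL-Probability.Probability"
begin

definition asymmetric_laplace_density :: "real \<Rightarrow> real \<Rightarrow> real \<Rightarrow> real \<Rightarrow> real" where
  "asymmetric_laplace_density \<mu> a b x =
     1 / sqrt (2 * b\<^sup>2 + a\<^sup>2) *
       exp (a / b\<^sup>2 * (x - \<mu>) - 1 / b * sqrt (2 + a\<^sup>2 / b\<^sup>2) * \<bar>x - \<mu>\<bar>)"

definition asymmetric_laplace :: "real \<Rightarrow> real \<Rightarrow> real \<Rightarrow> real measure" where
  "asymmetric_laplace \<mu> a b = density lborel (asymmetric_laplace_density \<mu> a b)"

text \<open>
  Absolute continuity in the epsilon-delta form: a finite family of non-overlapping intervals is a
  finite set of pairs of endpoints. Degenerate intervals contribute nothing and are left out.

  If \<open>deriv f\<close> is locally absolutely continuous, \<open>deriv (deriv f)\<close> is the second derivative at almost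
  every point; on the exceptional null set \<open>deriv\<close> returns an unspecified constant.
\<close>

definition abs_continuous_on :: "real set \<Rightarrow> (real \<Rightarrow> real) \<Rightarrow> bool" where
  "abs_continuous_on S f \<longleftrightarrow>
     (\<forall>\<epsilon>>0. \<exists>\<delta>>0. \<forall>P. finite P \<longrightarrow>
        (\<forall>(u, v)\<in>P. u < v \<and> {u..v} \<subseteq> S) \<longrightarrow>
        pairwise (\<lambda>(u, v) (u', v'). disjnt {u<..<v} {u'<..<v'}) P \<longrightarrow>
        (\<Sum>(u, v)\<in>P. v - u) < \<delta> \<longrightarrow>
        (\<Sum>(u, v)\<in>P. \<bar>f v - f u\<bar>) < \<epsilon>)"

definition locally_abs_continuous :: "(real \<Rightarrow> real) \<Rightarrow> bool" where
  "locally_abs_continuous f \<longleftrightarrow> (\<forall>l u. abs_continuous_on {l..u} f)"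

text \<open>
  The density above does have the characteristic function by which the distribution is
  specified (and so, by uniqueness, the definition is the intended one).
\<close>

lemma has_bochner_integral_exp_atLeast_0:
  fixes c :: complex
  assumes c: "Re c > 0"
  shows "has_bochner_integral lborel (\<lambda>x. indicator {0<..} x *\<^sub>R exp (- c * complex_of_real x)) (1 / c)"
proof -
  have c0: "c \<noteq> 0" using c by auto
  have ein: "einterval 0 \<infinity> = {0<..}"
    by (auto simp: einterval_def)
  have "set_integrable lborel (einterval 0 \<infinity>) (\<lambda>x. exp (- Re c * x))"
  proof (rule interval_integral_FTC_nonneg(1)[where F = "\<lambda>x. - exp (- Re c * x) / Re c"
        and A = "- 1 / Re c" and B = 0])
    show "((\<lambda>x. - exp (- Re c * x) / Re c) has_field_derivative exp (- Re c * x)) (at x)" for x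
      using c by (auto intro!: derivative_eq_intros)
    show "(((\<lambda>x. - exp (- Re c * x) / Re c) \<circ> real_of_ereal) \<longlongrightarrow> - 1 / Re c) (at_right 0)"
      unfolding zero_ereal_def
      by (subst ereal_tendsto_simps1) (use c in \<open>auto intro!: tendsto_eq_intros\<close>)
    have "((\<lambda>x. - exp (- Re c * x) / Re c) \<longlongrightarrow> 0) at_top"
      using c by real_asymp
    then show "(((\<lambda>x. - exp (- Re c * x) / Re c) \<circ> real_of_ereal) \<longlongrightarrow> 0) (at_left \<infinity>)"
      by (simp add: ereal_tendsto_simps1)
  qed (auto intro!: continuous_intros)
  then have R: "integrable lborel (\<lambda>x. indicator {0<..} x *\<^sub>R exp (- Re c * x))"
    by (simp add: set_integrable_def ein)
  have I: "integrable lborel (\<lambda>x. indicator {0<..} x *\<^sub>R exp (- c * complex_of_real x))"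
    by (rule Bochner_Integration.integrable_bound[OF R])
       (auto simp: norm_exp_eq_Re split: split_indicator)
  have "(LBINT x=0..\<infinity>. exp (- c * complex_of_real x)) = 0 - (- 1 / c)"
  proof (rule interval_integral_FTC_integrable[where F = "\<lambda>x. - exp (- c * complex_of_real x) / c"])
    show "((\<lambda>x. - exp (- c * complex_of_real x) / c) has_vector_derivative
             exp (- c * complex_of_real x)) (at x)" for x
    proof -
      have "((\<lambda>z. - exp (- c * z) / c) has_field_derivative exp (- c * z)) (at z)" for z
        using c0 by (auto intro!: derivative_eq_intros)
      from has_vector_derivative_real_field[OF this] show ?thesis by simp
    qed
    show "set_integrable lborel (einterval 0 \<infinity>) (\<lambda>x. exp (- c * complex_of_real x))"
      using I by (simp add: set_integrable_def ein)
    show "(((\<lambda>x. - exp (- c * complex_of_real x) / c) \<circ> real_of_ereal) \<longlongrightarrow> - 1 / c) (at_right 0)"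
      unfolding zero_ereal_def
      by (subst ereal_tendsto_simps1) (use c0 in \<open>auto intro!: tendsto_eq_intros\<close>)
    have "((\<lambda>x. exp (- Re c * x) / cmod c) \<longlongrightarrow> 0) at_top"
      using c c0 by real_asymp
    then have "((\<lambda>x. - exp (- c * complex_of_real x) / c) \<longlongrightarrow> 0) at_top"
      by (rule tendsto_norm_zero_cancel[OF Lim_transform_eventually])
         (auto simp: norm_divide norm_exp_eq_Re)
    then show "(((\<lambda>x. - exp (- c * complex_of_real x) / c) \<circ> real_of_ereal) \<longlongrightarrow> 0) (at_left \<infinity>)"
      by (simp add: ereal_tendsto_simps1)
  qed (auto intro!: continuous_intros)
  then have "(LINT x|lborel. indicator {0<..} x *\<^sub>R exp (- c * complex_of_real x)) = 1 / c"
    by (simp add: interval_lebesgue_integral_def set_lebesgue_integral_def ein)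
  with I show ?thesis by (simp add: has_bochner_integral_iff)
qed

lemma asymmetric_laplace_density_nonneg: "0 \<le> asymmetric_laplace_density \<mu> a b x"
  by (simp add: asymmetric_laplace_density_def)

lemma measurable_asymmetric_laplace_density [measurable]:
  "asymmetric_laplace_density \<mu> a b \<in> borel_measurable borel"
  unfolding asymmetric_laplace_density_def by measurable

lemma has_bochner_integral_iexp_asymmetric_laplace:
  assumes b: "b > 0"
  shows "has_bochner_integral lborel
           (\<lambda>x. asymmetric_laplace_density \<mu> a b x *\<^sub>R iexp (t * x))
           (iexp (\<mu> * t) / (1 + b\<^sup>2 * t\<^sup>2 / 2 - \<i> * a * t))"
proof -
  define s where "s = sqrt (2 * b\<^sup>2 + a\<^sup>2)"
  define p where "p = (s - a) / b\<^sup>2"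
  define q where "q = (s + a) / b\<^sup>2"
  have s2: "s\<^sup>2 = 2 * b\<^sup>2 + a\<^sup>2" by (simp add: s_def)
  have "sqrt (a\<^sup>2) < s" unfolding s_def using b by (intro real_sqrt_less_mono) auto
  then have sa: "\<bar>a\<bar> < s" by simp
  then have s0: "s > 0" by linarith
  have p0: "p > 0" and q0: "q > 0" using sa b by (auto simp: p_def q_def)
  have "1 / b * sqrt (2 + a\<^sup>2 / b\<^sup>2) = 1 / b * sqrt ((2 * b\<^sup>2 + a\<^sup>2) / b\<^sup>2)"
    using b by (simp add: field_simps)
  also have "\<dots> = s / b\<^sup>2"
    using b by (simp add: real_sqrt_divide s_def power2_eq_square)
  finally have rate: "1 / b * sqrt (2 + a\<^sup>2 / b\<^sup>2) = s / b\<^sup>2" .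
  define g where "g = (\<lambda>x. asymmetric_laplace_density \<mu> a b x *\<^sub>R iexp (t * x))"
  define c where "c = Complex p (- t)"
  define d where "d = Complex q t"
  have H1: "has_bochner_integral lborel (\<lambda>x. indicator {0<..} x *\<^sub>R exp (- c * complex_of_real x)) (1 / c)"
    using p0 by (intro has_bochner_integral_exp_atLeast_0) (simp add: c_def)
  have H2: "has_bochner_integral lborel (\<lambda>x. indicator {0<..} x *\<^sub>R exp (- d * complex_of_real x)) (1 / d)"
    using q0 by (intro has_bochner_integral_exp_atLeast_0) (simp add: d_def)
  have H2': "has_bochner_integral lborel
      (\<lambda>x. indicator {0<..} (-x) *\<^sub>R exp (- d * complex_of_real (-x))) (1 / d)"
    using lborel_has_bochner_integral_real_affine_iff[of "-1"
        "\<lambda>x. indicator {0<..} x *\<^sub>R exp (- d * complex_of_real x)" "1 / d" 0] H2 by simp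
  have H3: "has_bochner_integral lborel
     (\<lambda>x. (iexp (\<mu> * t) / s) * (indicator {0<..} x *\<^sub>R exp (- c * complex_of_real x)
        + indicator {0<..} (-x) *\<^sub>R exp (- d * complex_of_real (-x))))
     ((iexp (\<mu> * t) / s) * (1 / c + 1 / d))"
    by (intro has_bochner_integral_mult_right has_bochner_integral_add H1 H2')
  have eq: "(iexp (\<mu> * t) / s) * (indicator {0<..} x *\<^sub>R exp (- c * complex_of_real x)
        + indicator {0<..} (-x) *\<^sub>R exp (- d * complex_of_real (-x))) = g (\<mu> + 1 * x)"
    if x: "x \<noteq> 0" for x
  proof -
    have g: "g (\<mu> + x) = (iexp (\<mu> * t) / s) * (complex_of_real (exp (a / b\<^sup>2 * x - s / b\<^sup>2 * \<bar>x\<bar>)) * iexp (t * x))"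
      unfolding g_def asymmetric_laplace_density_def rate s_def[symmetric]
      by (simp add: scaleR_conv_of_real exp_add algebra_simps)
    show ?thesis
    proof (cases "x > 0")
      case True
      have "a / b\<^sup>2 * x - s / b\<^sup>2 * \<bar>x\<bar> = - p * x"
        using True b by (simp add: p_def field_simps)
      then have "complex_of_real (exp (a / b\<^sup>2 * x - s / b\<^sup>2 * \<bar>x\<bar>)) * iexp (t * x)
          = exp (complex_of_real (- p * x) + \<i> * (t * x))"
        by (simp only: exp_add exp_of_real)
      also have "complex_of_real (- p * x) + \<i> * (t * x) = - c * x"
        by (simp add: c_def complex_eq_iff)
      finally show ?thesis using True g by simp
    next
      case False
      with x have x: "x < 0" by simp
      have "a / b\<^sup>2 * x - s / b\<^sup>2 * \<bar>x\<bar> = q * x"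
        using x b by (simp add: q_def field_simps)
      then have "complex_of_real (exp (a / b\<^sup>2 * x - s / b\<^sup>2 * \<bar>x\<bar>)) * iexp (t * x)
          = exp (complex_of_real (q * x) + \<i> * (t * x))"
        by (simp only: exp_add exp_of_real)
      also have "complex_of_real (q * x) + \<i> * (t * x) = - d * complex_of_real (-x)"
        by (simp add: d_def complex_eq_iff)
      finally show ?thesis using x g by simp
    qed
  qed
  have meas: "g \<in> borel_measurable borel" unfolding g_def by measurable
  have "has_bochner_integral lborel (\<lambda>x. g (\<mu> + 1 * x)) ((iexp (\<mu> * t) / s) * (1 / c + 1 / d))"
  proof (rule has_bochner_integral_cong_AE[THEN iffD1, OF _ _ _ H3])
    have "AE x in lborel. x \<noteq> (0::real)"
      by (rule AE_lborel_singleton)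
    then show "AE x in lborel. (iexp (\<mu> * t) / s) * (indicator {0<..} x *\<^sub>R exp (- c * complex_of_real x)
        + indicator {0<..} (-x) *\<^sub>R exp (- d * complex_of_real (-x))) = g (\<mu> + 1 * x)"
      by eventually_elim (rule eq)
    show "(\<lambda>x. g (\<mu> + 1 * x)) \<in> borel_measurable lborel" using meas by measurable
  qed (use H3 in \<open>auto dest: borel_measurable_has_bochner_integral\<close>)
  then have "has_bochner_integral lborel g ((iexp (\<mu> * t) / s) * (1 / c + 1 / d))"
    using lborel_has_bochner_integral_real_affine_iff[of 1 g _ \<mu>] by simp
  moreover have "(iexp (\<mu> * t) / s) * (1 / c + 1 / d) =
      iexp (\<mu> * t) / (1 + b\<^sup>2 * t\<^sup>2 / 2 - \<i> * a * t)"
  proof -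
    have pq: "p * q = 2 / b\<^sup>2"
      using b s2 by (simp add: p_def q_def field_simps power2_eq_square)
    have pmq: "p - q = - 2 * a / b\<^sup>2" and ppq: "p + q = 2 * s / b\<^sup>2"
      using b by (simp_all add: p_def q_def field_simps)
    have c0: "c \<noteq> 0" and d0: "d \<noteq> 0" using p0 q0 by (auto simp: c_def d_def complex_eq_iff)
    have bb: "b\<^sup>2 / 2 * (p * q) = 1" "b\<^sup>2 / 2 * (p - q) = - a" "b\<^sup>2 / 2 * (p + q) = s"
      using b by (simp_all add: pq pmq ppq)
    have cd: "complex_of_real (b\<^sup>2 / 2) * (c * d) = 1 + b\<^sup>2 * t\<^sup>2 / 2 - \<i> * a * t"
    proof (rule complex_eqI)
      have "Re (complex_of_real (b\<^sup>2 / 2) * (c * d)) = b\<^sup>2 / 2 * (p * q) + b\<^sup>2 * t\<^sup>2 / 2"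
        by (simp add: c_def d_def algebra_simps power2_eq_square)
      also have "\<dots> = 1 + b\<^sup>2 * t\<^sup>2 / 2"
        by (simp only: bb)
      finally show "Re (complex_of_real (b\<^sup>2 / 2) * (c * d)) = Re (1 + b\<^sup>2 * t\<^sup>2 / 2 - \<i> * a * t)"
        by (simp flip: of_real_power of_real_mult)
      have "Im (complex_of_real (b\<^sup>2 / 2) * (c * d)) = b\<^sup>2 / 2 * (p - q) * t"
        by (simp add: c_def d_def algebra_simps power2_eq_square)
      also have "\<dots> = - a * t"
        by (simp only: bb)
      finally show "Im (complex_of_real (b\<^sup>2 / 2) * (c * d)) = Im (1 + b\<^sup>2 * t\<^sup>2 / 2 - \<i> * a * t)"
        by (simp flip: of_real_power of_real_mult)
    qed
    have "c + d = complex_of_real (p + q)"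
      by (simp add: c_def d_def complex_eq_iff)
    then have sd: "complex_of_real s = complex_of_real (b\<^sup>2 / 2) * (c + d)"
      by (simp only: bb(3) flip: of_real_mult)
    have s1: "complex_of_real (b\<^sup>2 / 2) * (c + d) \<noteq> 0" using s0 unfolding sd[symmetric] by simp
    have "(1 / complex_of_real s) * (1 / c + 1 / d) = 1 / (complex_of_real (b\<^sup>2 / 2) * (c * d))"
    proof -
      have "1 / c + 1 / d = (c + d) / (c * d)" using c0 d0 by (simp add: field_simps)
      moreover have "1 / (k * u) * (u / v) = 1 / (k * v)" if "k * u \<noteq> 0" for k u v :: complex
        using that by auto
      note this[OF s1]
      ultimately show ?thesis unfolding sd by (simp only:)
    qed
    moreover have "(u / k) * v = u / w" if "1 / k * v = 1 / w" for u k v w :: complex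
      using arg_cong[OF that, of "\<lambda>z. u * z"] by simp
    ultimately show ?thesis unfolding cd by blast
  qed
  ultimately show ?thesis by (simp add: g_def)
qed

lemma char_asymmetric_laplace:
  assumes "b > 0"
  shows "char (asymmetric_laplace \<mu> a b) t = iexp (\<mu> * t) / (1 + b\<^sup>2 * t\<^sup>2 / 2 - \<i> * a * t)"
proof -
  have "char (asymmetric_laplace \<mu> a b) t = (LINT x|lborel. asymmetric_laplace_density \<mu> a b x *\<^sub>R iexp (t * x))"
    unfolding char_def asymmetric_laplace_def
    by (rule integral_density) (auto simp: asymmetric_laplace_density_nonneg)
  with has_bochner_integral_iexp_asymmetric_laplace[OF assms, of \<mu> a t]
  show ?thesis by (simp add: has_bochner_integral_iff)
qed

lemma real_distribution_asymmetric_laplace: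
  assumes "b > 0"
  shows "real_distribution (asymmetric_laplace \<mu> a b)"
proof -
  have 1: "has_bochner_integral lborel (\<lambda>x. complex_of_real (asymmetric_laplace_density \<mu> a b x)) 1"
    using has_bochner_integral_iexp_asymmetric_laplace[OF assms, of \<mu> a 0]
    by (simp add: scaleR_conv_of_real)
  then have "has_bochner_integral lborel (asymmetric_laplace_density \<mu> a b) 1"
    using has_bochner_integral_bounded_linear[OF bounded_linear_Re 1] by simp
  then have "emeasure (asymmetric_laplace \<mu> a b) UNIV = 1"
    by (simp add: asymmetric_laplace_def emeasure_density has_bochner_integral_iff
        nn_integral_eq_integral asymmetric_laplace_density_nonneg)
  then have "prob_space (asymmetric_laplace \<mu> a b)"
    by (intro prob_spaceI) (simp add: asymmetric_laplace_def)
  then show ?thesis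
    by (simp add: real_distribution_def real_distribution_axioms_def asymmetric_laplace_def)
qed

end

theory Submission
  imports Defs
begin

text \<open>
  Let \<open>Z\<close> follow the asymmetric Laplace distribution, with density \<open>\<rho>\<close>. It solves \<open>b\<^sup>2/2 * \<rho>'' - a * \<rho>' - \<rho> = 0\<close> on either side of \<open>\<mu>\<close>, where it is a
  pure exponential, and it has a kink at \<open>\<mu>\<close>. The operator \<open>b\<^sup>2/2 * f'' + a * f' - (f - f \<mu>)\<close> is the adjoint of
  this equation, so partial integration of its expectation leaves, on each half-line, only a boundary
  term at \<open>\<mu>\<close>; both terms are \<open>b\<^sup>2/2 * \<rho> \<mu> * f' \<mu>\<close> up to sign, and they cancel. This is the forward
  direction. Conversely, the identity for the two bounded test functions \<open>x \<mapsto> cos (t * x)\<close> and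
  \<open>x \<mapsto> sin (t * x)\<close> is a linear equation for the characteristic function of \<open>W\<close> at \<open>t\<close>, whose
  only solution is that of \<open>Z\<close>, and a characteristic function determines the law.

  Two points of the forward direction need more than calculus. First, no boundary term at infinity is
  ever formed: on a half-line with density proportional to \<open>exp (- r * x)\<close>, Fubini's theorem turns the integral of
  \<open>exp (- r * x)\<close> against a primitive of \<open>k\<close> into that of \<open>exp (- r * x) * k x / r\<close>
  (\<open>exponential_integral_of_primitive\<close>). This gives both the integrability of \<open>f (Z) - f \<mu>\<close> and
  everything that partial integration would give, when it is applied once to \<open>k = f'\<close> and once to
  \<open>k = f''\<close> (\<open>one_sided_stein_integral\<close>).

  Second, \<open>f'\<close> must be recovered from \<open>deriv (deriv f)\<close>, which makes sense only almost everywhere. So it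
  has to be proved that an absolutely continuous function is differentiable almost everywhere and is
  the integral of its derivative. Differentiability comes from Vitali's covering theorem, applied
  twice: where the upper derivative exceeds \<open>q\<close> and the lower one is below \<open>p < q\<close>, a set \<open>E\<close> of positive
  measure would be nearly filled by intervals of slope above \<open>q\<close>, and these in turn by intervals of slope
  below \<open>p\<close>; the total increments over both families differ only by increments over short gaps, which
  absolute continuity makes small (\<open>straddled_slopes_negligible\<close>). This direct estimate of the gaps takes
  the place of the usual splitting into monotone functions. The integral
  formula is then a Henstock-Kurzweil argument: an interval tagged where the derivative exists
  contributes a small error relative to its length, and those tagged in the exceptional null set have
  small total length, hence small total increment (\<open>abs_continuous_on_FTC\<close>).
\<close>

section \<open>Packings by non-overlapping intervals\<close>

definition interval_packing :: "real set \<Rightarrow> (real \<times> real) set \<Rightarrow> bool" where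
  "interval_packing S P \<longleftrightarrow>
     finite P \<and> (\<forall>(u, v)\<in>P. u < v \<and> {u..v} \<subseteq> S) \<and>
     pairwise (\<lambda>(u, v) (u', v'). disjnt {u<..<v} {u'<..<v'}) P"

definition increment :: "(real \<Rightarrow> real) \<Rightarrow> (real \<times> real) set \<Rightarrow> real" where
  "increment h P = (\<Sum>(u, v)\<in>P. h v - h u)"

abbreviation total_length :: "(real \<times> real) set \<Rightarrow> real" where
  "total_length \<equiv> increment (\<lambda>x. x)"

lemma interval_packing_iff:
  "interval_packing S P \<longleftrightarrow> finite P \<and> (\<forall>u v. (u, v) \<in> P \<longrightarrow> u < v \<and> {u..v} \<subseteq> S) \<and>
     (\<forall>u v u' v'. (u, v) \<in> P \<longrightarrow> (u', v') \<in> P \<longrightarrow> (u, v) \<noteq> (u', v') \<longrightarrow> disjnt {u<..<v} {u'<..<v'})"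
  unfolding interval_packing_def pairwise_def Ball_def split_paired_All prod.case by blast

lemma interval_packingD:
  "interval_packing {s..t} P \<Longrightarrow> (u, v) \<in> P \<Longrightarrow> u < v \<and> s \<le> u \<and> v \<le> t"
  by (fastforce simp: interval_packing_def)

lemma interval_packing_mono: "interval_packing S P \<Longrightarrow> S \<subseteq> T \<Longrightarrow> interval_packing T P"
  unfolding interval_packing_def by fast

lemma total_length_nonneg: "interval_packing S P \<Longrightarrow> 0 \<le> total_length P"
  unfolding interval_packing_def increment_def by (intro sum_nonneg) auto

lemma abs_continuous_on_packing:
  assumes "abs_continuous_on S f" "0 < e"
  obtains d where "0 < d"
    "\<And>P. interval_packing S P \<Longrightarrow> total_length P < d \<Longrightarrow> (\<Sum>(u, v)\<in>P. \<bar>f v - f u\<bar>) < e"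
proof -
  from assms obtain d where "0 < d" and d: "\<And>P. finite P \<Longrightarrow> \<forall>(u, v)\<in>P. u < v \<and> {u..v} \<subseteq> S \<Longrightarrow>
      pairwise (\<lambda>(u, v) (u', v'). disjnt {u<..<v} {u'<..<v'}) P \<Longrightarrow>
      (\<Sum>(u, v)\<in>P. v - u) < d \<Longrightarrow> (\<Sum>(u, v)\<in>P. \<bar>f v - f u\<bar>) < e"
    unfolding abs_continuous_on_def by blast
  show thesis
  proof
    fix P assume P: "interval_packing S P" and len: "total_length P < d"
    from P have "finite P" "\<forall>(u, v)\<in>P. u < v \<and> {u..v} \<subseteq> S"
      "pairwise (\<lambda>(u, v) (u', v'). disjnt {u<..<v} {u'<..<v'}) P"
      unfolding interval_packing_def by blast+
    then show "(\<Sum>(u, v)\<in>P. \<bar>f v - f u\<bar>) < e"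
      using d len unfolding increment_def by blast
  qed (fact \<open>0 < d\<close>)
qed

lemma abs_increment_le: "\<bar>increment h P\<bar> \<le> (\<Sum>(u, v)\<in>P. \<bar>h v - h u\<bar>)"
  unfolding increment_def
  by (rule order_trans[OF sum_abs]) (simp add: case_prod_beta)

text \<open>
  The gaps left by a packing of \<open>{s..t}\<close> form a packing again. Quantifying over \<open>h\<close> in the conclusion
  gives at once that the lengths add up (\<open>h\<close> the identity) and that the increments of a given function
  telescope. The induction removes the rightmost interval \<open>(u, v)\<close> and applies the hypothesis to \<open>{s..u}\<close>.
\<close>

lemma complementary_packing:
  assumes "interval_packing {s..t} P" "s \<le> t"
  shows "\<exists>Q. interval_packing {s..t} Q \<and> (\<forall>h. increment h P + increment h Q = h t - h s)"
  using assms
proof (induction "card P" arbitrary: P t)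
  case 0
  then have "P = {}" by (auto simp: interval_packing_def)
  then show ?case
    using \<open>s \<le> t\<close>
    by (intro exI[of _ "if s < t then {(s, t)} else {}"]) (auto simp: interval_packing_def increment_def)
next
  case (Suc n)
  have sub: "\<And>u v. (u, v) \<in> P \<Longrightarrow> u < v \<and> s \<le> u \<and> v \<le> t"
    using interval_packingD[OF Suc.prems(1)] .
  have fin: "finite P"
    and dis: "pairwise (\<lambda>(u, v) (u', v'). disjnt {u<..<v} {u'<..<v'}) P"
    using Suc.prems by (auto simp: interval_packing_def)
  have "P \<noteq> {}" using Suc.hyps(2) by auto
  then have "Max (snd ` P) \<in> snd ` P" using fin by (intro Max_in) auto
  then obtain u v where uv: "(u, v) \<in> P" and v: "v = Max (snd ` P)" by force
  have max: "v' \<le> v" if "(u', v') \<in> P" for u' v'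
    unfolding v using fin that by (intro Max_ge) force+
  define P' where "P' = P - {(u, v)}"
  have left: "v' \<le> u" if "(u', v') \<in> P'" for u' v'
  proof (rule ccontr)
    assume "\<not> v' \<le> u"
    with sub[OF uv] sub[of u' v'] that max[of u' v'] have m: "max u u' < v'" "v' \<le> v"
      by (auto simp: P'_def)
    have "disjnt {u'<..<v'} {u<..<v}"
      using dis uv that unfolding pairwise_def P'_def by force
    moreover have "(max u u' + v') / 2 \<in> {u'<..<v'} \<inter> {u<..<v}"
      using m by auto
    ultimately show False by (auto simp: disjnt_def)
  qed
  have P': "interval_packing {s..u} P'"
    unfolding interval_packing_def
  proof (intro conjI)
    show "finite P'" using fin by (simp add: P'_def)
    show "pairwise (\<lambda>(u, v) (u', v'). disjnt {u<..<v} {u'<..<v'}) P'"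
      using dis by (rule pairwise_subset) (auto simp: P'_def)
    show "\<forall>(u', v')\<in>P'. u' < v' \<and> {u'..v'} \<subseteq> {s..u}"
      using left sub by (fastforce simp: P'_def)
  qed
  have "n = card P'" using Suc.hyps(2) fin uv by (simp add: P'_def)
  from Suc.hyps(1)[OF this P'] sub[OF uv] obtain Q'
    where Q': "interval_packing {s..u} Q'" and eq: "\<And>h. increment h P' + increment h Q' = h u - h s"
    by auto
  have incP: "increment h P = increment h P' + (h v - h u)" for h
    using fin uv by (simp add: increment_def P'_def sum.remove)
  show ?case
  proof (cases "v < t")
    case False
    with sub[OF uv] have "v = t" by auto
    moreover have "interval_packing {s..t} Q'"
      by (rule interval_packing_mono[OF Q']) (use sub[OF uv] in auto)
    ultimately show ?thesis
      by (intro exI[of _ Q'] conjI allI) (simp_all only: incP, use eq in \<open>simp add: algebra_simps\<close>)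
  next
    case True
    have notin: "(v, t) \<notin> Q'" using interval_packingD[OF Q'] sub[OF uv] True by force
    have "interval_packing {s..t} (insert (v, t) Q')"
      unfolding interval_packing_iff
    proof (intro conjI allI impI)
      have Q'u: "u' < v' \<and> s \<le> u' \<and> v' \<le> u" if "(u', v') \<in> Q'" for u' v'
        using interval_packingD[OF Q' that] .
      show "finite (insert (v, t) Q')" using Q' by (simp add: interval_packing_iff)
      fix x y assume xy: "(x, y) \<in> insert (v, t) Q'"
      then show "x < y" "{x..y} \<subseteq> {s..t}" using Q'u[of x y] sub[OF uv] True by auto
      fix x' y' assume xy': "(x', y') \<in> insert (v, t) Q'" and ne: "(x, y) \<noteq> (x', y')"
      show "disjnt {x<..<y} {x'<..<y'}"
      proof (cases "(x, y) \<in> Q' \<and> (x', y') \<in> Q'")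
        case True
        then show ?thesis using Q' ne unfolding interval_packing_iff by blast
      next
        case False
        then show ?thesis using xy xy' ne Q'u[of x y] Q'u[of x' y'] sub[OF uv]
          by (auto simp: disjnt_def)
      qed
    qed
    moreover have "increment h (insert (v, t) Q') = increment h Q' + (h t - h v)" for h
      using Q' notin by (simp add: increment_def interval_packing_def)
    ultimately show ?thesis
      by (intro exI[of _ "insert (v, t) Q'"] conjI allI)
        (simp_all only: incP, use eq in \<open>simp add: algebra_simps\<close>)
  qed
qed

lemma interval_packing_UN:
  assumes P: "interval_packing S P"
    and Q: "\<And>s t. (s, t) \<in> P \<Longrightarrow> interval_packing {s..t} (Q (s, t))"
  shows "interval_packing S (\<Union>I\<in>P. Q I)"
    and "increment h (\<Union>I\<in>P. Q I) = (\<Sum>I\<in>P. increment h (Q I))"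
proof -
  have dis: "disjnt {u<..<v} {u'<..<v'}"
    if "(u, v) \<in> Q I" "(u', v') \<in> Q J" "I \<in> P" "J \<in> P" "I \<noteq> J" for u v u' v' I J
  proof -
    obtain s t s' t' where IJ: "I = (s, t)" "J = (s', t')" by (cases I, cases J)
    have "disjnt {s<..<t} {s'<..<t'}"
      using P that IJ unfolding interval_packing_iff by blast
    moreover have "{u<..<v} \<subseteq> {s<..<t}"
      using Q[of s t] that IJ unfolding interval_packing_iff by force
    moreover have "{u'<..<v'} \<subseteq> {s'<..<t'}"
      using Q[of s' t'] that IJ unfolding interval_packing_iff by force
    ultimately show ?thesis by (meson disjnt_subset1 disjnt_subset2)
  qed
   have disQ: "Q I \<inter> Q J = {}" if "I \<in> P" "J \<in> P" "I \<noteq> J" for I J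
  proof (rule ccontr)
    assume "Q I \<inter> Q J \<noteq> {}"
    then obtain u v where uv: "(u, v) \<in> Q I" "(u, v) \<in> Q J" by auto
    with \<open>I \<in> P\<close> have "(u + v) / 2 \<in> {u<..<v}"
      using Q[of "fst I" "snd I"] by (auto simp: interval_packing_iff)
    then show False using dis[OF uv that] by (auto simp: disjnt_def)
  qed
  have finP: "finite P" and finQ: "\<And>I. I \<in> P \<Longrightarrow> finite (Q I)"
    using P Q by (auto simp: interval_packing_def)
  show "increment h (\<Union>I\<in>P. Q I) = (\<Sum>I\<in>P. increment h (Q I))"
    unfolding increment_def using finP finQ disQ by (intro sum.UNION_disjoint) auto
  show "interval_packing S (\<Union>I\<in>P. Q I)"
    unfolding interval_packing_iff
  proof (intro conjI allI impI)
    show "finite (\<Union>I\<in>P. Q I)" using finP finQ by auto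
    fix u v assume "(u, v) \<in> (\<Union>I\<in>P. Q I)"
    then obtain s t where st: "(s, t) \<in> P" "(u, v) \<in> Q (s, t)" by force
    then have "{u..v} \<subseteq> {s..t}" using Q unfolding interval_packing_iff by blast
    moreover have "{s..t} \<subseteq> S" using P st unfolding interval_packing_iff by blast
    ultimately show "{u..v} \<subseteq> S" by (rule order_trans)
    show "u < v" using Q st unfolding interval_packing_iff by blast
    fix u' v' assume "(u', v') \<in> (\<Union>I\<in>P. Q I)" and ne: "(u, v) \<noteq> (u', v')"
    then obtain s' t' where st': "(s', t') \<in> P" "(u', v') \<in> Q (s', t')" by force
    show "disjnt {u<..<v} {u'<..<v'}"
    proof (cases "(s, t) = (s', t')")
      case True
      then show ?thesis using Q[of s t] st st' ne unfolding interval_packing_iff by blast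
    next
      case False
      then show ?thesis using dis st st' by blast
    qed
  qed
qed

text \<open>
  The covering theorem gives countably many closed intervals that cover almost all of \<open>E\<close>; finitely many
  of them already cover it up to measure \<open>e\<close>. The predicate \<open>R\<close> stands for a bound on
  the slope of a function over the interval.
\<close>

lemma Vitali_interval_packing:
  assumes E: "E \<in> lmeasurable" "E \<subseteq> U" and U: "open U"
    and cov: "\<And>x d. x \<in> E \<Longrightarrow> 0 < d \<Longrightarrow> \<exists>u v. u < x \<and> x < v \<and> v - u < d \<and> R u v"
    and e: "0 < e"
  obtains P where "interval_packing U P" "\<And>u v. (u, v) \<in> P \<Longrightarrow> R u v"
    "measure lebesgue E - e < total_length P"
proof -
  define K where "K = {(u, v). u < v \<and> {u..v} \<subseteq> U \<and> R u v}"
  define c r where "c = (\<lambda>(u, v). (u + v) / 2 :: real)" and "r = (\<lambda>(u, v). (v - u) / 2 :: real)"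
  have cb: "cball (c (u, v)) (r (u, v)) = {u..v}" for u v
    by (simp add: c_def r_def cball_eq_atLeastAtMost field_simps)
  obtain C where C: "countable C" "C \<subseteq> K"
    "pairwise (\<lambda>i j. disjnt (cball (c i) (r i)) (cball (c j) (r j))) C"
    "negligible (E - (\<Union>i\<in>C. cball (c i) (r i)))"
  proof (rule Vitali_covering_theorem_cballs[of K r E c])
    show "0 < r i" if "i \<in> K" for i using that by (auto simp: K_def r_def)
    show "\<exists>i. i \<in> K \<and> x \<in> cball (c i) (r i) \<and> r i < d" if x: "x \<in> E" and d: "0 < d" for x d
    proof -
      obtain e' where e': "0 < e'" "ball x e' \<subseteq> U" using U E x by (meson open_contains_ball subsetD)
      with d obtain u v where uv: "u < x" "x < v" "v - u < min d e'" "R u v"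
        using cov[OF x, of "min d e'"] by auto
      have "{u..v} \<subseteq> ball x e'" using uv by (auto simp: dist_real_def)
      then show ?thesis
        using uv d e' unfolding K_def
        by (intro exI[of _ "(u, v)"] conjI, unfold cb) (auto simp: r_def)
    qed
  qed auto
  define D where "D = (\<lambda>(u, v). {u..v} \<inter> E) ` C"
  have meas: "d \<in> lmeasurable" if "d \<in> D" for d
    using that E by (auto simp: D_def intro!: fmeasurable_Int_fmeasurable)
  have UD: "measure lebesgue (\<Union>D) = measure lebesgue E"
  proof (rule measure_negligible_symdiff[OF E(1)])
    have "E - \<Union>D \<union> (\<Union>D - E) = E - (\<Union>i\<in>C. cball (c i) (r i))"
      by (auto simp: D_def cb simp del: mem_cball)
    then show "negligible (E - \<Union>D \<union> (\<Union>D - E))" using C(4) by simp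
  qed
  have "measure lebesgue (\<Union>D') \<le> measure lebesgue E" if "D' \<subseteq> D" "finite D'" for D'
    using that meas E by (intro measure_mono_fmeasurable) (auto simp: D_def)
  then obtain D' where D': "D' \<subseteq> D" "finite D'" "measure lebesgue (\<Union>D) - e < measure lebesgue (\<Union>D')"
    using measure_countable_Union_approachable[of D e "measure lebesgue E"] C(1) e meas
    by (metis D_def countable_image)
  then obtain P where P: "P \<subseteq> C" "finite P" "D' = (\<lambda>(u, v). {u..v} \<inter> E) ` P"
    unfolding D_def by (meson finite_subset_image)
  have inK: "u < v \<and> {u..v} \<subseteq> U \<and> R u v" if "(u, v) \<in> P" for u v
    using that P C by (auto simp: K_def)
  show thesis
  proof
    show "interval_packing U P"
      unfolding interval_packing_iff
    proof (intro conjI allI impI)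
      fix u v u' v' assume *: "(u, v) \<in> P" "(u', v') \<in> P" "(u, v) \<noteq> (u', v')"
      with C(3) P have "disjnt (cball (c (u, v)) (r (u, v))) (cball (c (u', v')) (r (u', v')))"
        unfolding pairwise_def by blast
      then show "disjnt {u<..<v} {u'<..<v'}" unfolding cb by (auto simp: disjnt_def)
    qed (use P inK in auto)
    have "measure lebesgue (\<Union>D') \<le> (\<Sum>(u, v)\<in>P. measure lebesgue ({u..v} \<inter> E))"
      unfolding P(3) using P(2) E
      unfolding case_prod_beta
      by (intro measure_UNION_le fmeasurableD fmeasurable_Int_fmeasurable) auto
    also have "\<dots> \<le> (\<Sum>(u, v)\<in>P. measure lebesgue {u..v})"
    proof (intro sum_mono, clarify)
      fix u v show "measure lebesgue ({u..v} \<inter> E) \<le> measure lebesgue {u..v}"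
        using E(1) by (intro measure_mono_fmeasurable sets.Int fmeasurableD[OF E(1)]) auto
    qed
    also have "\<dots> = total_length P"
      unfolding increment_def by (intro sum.cong) (use inK in force)+
    finally show "measure lebesgue E - e < total_length P" using D' UD by simp
  qed (use inK in auto)
qed

lemma total_length_le_measure:
  assumes P: "interval_packing S P" and S: "S \<in> lmeasurable"
  shows "total_length P \<le> measure lebesgue S"
proof -
  have fin: "finite P" using P by (simp add: interval_packing_def)
  have "total_length P = (\<Sum>I\<in>P. measure lebesgue {fst I<..<snd I})"
    unfolding increment_def by (intro sum.cong) (use P in \<open>auto simp: interval_packing_iff less_imp_le\<close>)
  also have "\<dots> = measure lebesgue (\<Union>I\<in>P. {fst I<..<snd I})"
  proof (rule measure_finite_Union[symmetric])
    show "disjoint_family_on (\<lambda>I. {fst I<..<snd I}) P"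
      using P unfolding disjoint_family_on_def interval_packing_def pairwise_def disjnt_def by fastforce
    show "emeasure lebesgue {fst I<..<snd I} \<noteq> \<infinity>" for I :: "real \<times> real"
      unfolding infinity_ennreal_def by (rule fmeasurableD2) simp
  qed (auto simp: fin)
  also have "\<dots> \<le> measure lebesgue S"
  proof (rule measure_mono_fmeasurable[OF _ _ S])
    have "{u<..<v} \<subseteq> S" if "(u, v) \<in> P" for u v
      using P that greaterThanLessThan_subseteq_atLeastAtMost_iff[of u v u v]
      unfolding interval_packing_iff by fast
    then show "(\<Union>I\<in>P. {fst I<..<snd I}) \<subseteq> S" by (intro UN_least) (metis prod.collapse)
  qed (use fin in auto)
  finally show ?thesis .
qed

lemma abs_continuous_on_imp_continuous_on:
  assumes "abs_continuous_on {l..u} f"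
  shows "continuous_on {l..u} f"
  unfolding continuous_on_iff
proof (intro ballI allI impI)
  fix x and e :: real assume x: "x \<in> {l..u}" and e: "0 < e"
  obtain d where d: "0 < d" and
    ac: "\<And>P. interval_packing {l..u} P \<Longrightarrow> total_length P < d \<Longrightarrow> (\<Sum>(s, t)\<in>P. \<bar>f t - f s\<bar>) < e"
    using abs_continuous_on_packing[OF assms e] by blast
  have *: "\<bar>f t - f s\<bar> < e" if "s \<in> {l..u}" "t \<in> {l..u}" "s < t" "t - s < d" for s t
    using ac[of "{(s, t)}"] that by (auto simp: interval_packing_def increment_def)
  show "\<exists>d>0. \<forall>y\<in>{l..u}. dist y x < d \<longrightarrow> dist (f y) (f x) < e"
  proof (intro exI[of _ d] conjI ballI impI d)
    fix y assume y: "y \<in> {l..u}" "dist y x < d"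
    then show "dist (f y) (f x) < e"
      using *[of x y] *[of y x] x e by (cases x y rule: linorder_cases) (auto simp: dist_real_def)
  qed
qed

section \<open>Differentiability of absolutely continuous functions\<close>

text \<open>
  If \<open>E\<close> had measure \<open>m > 0\<close>, then choose a packing \<open>P\<close> of steep intervals which fills most of \<open>E\<close> inside a
  slightly larger open set, and inside each of them a packing \<open>F\<close> of flat intervals which fills most
  of \<open>E\<close> again. What remains of \<open>P\<close> is a packing \<open>GG\<close> of total length below \<open>d\<close>. The increment of \<open>f\<close> over
  \<open>P\<close> is at least \<open>q\<close> times its length, and at most \<open>p\<close> times the length of the flat part plus \<open>e\<close>;
  this is impossible since the gaps are short and the flat part has length at least \<open>3 * m / 4\<close>.
\<close>

lemma straddled_slopes_negligible:
  assumes ac: "abs_continuous_on {l..u} f"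
    and E: "E \<in> lmeasurable" "E \<subseteq> {l<..<u}" and pq: "p < q"
    and low: "\<And>x d. x \<in> E \<Longrightarrow> 0 < d \<Longrightarrow> \<exists>s t. s < x \<and> x < t \<and> t - s < d \<and> f t - f s < p * (t - s)"
    and high: "\<And>x d. x \<in> E \<Longrightarrow> 0 < d \<Longrightarrow> \<exists>s t. s < x \<and> x < t \<and> t - s < d \<and> q * (t - s) < f t - f s"
  shows "negligible E"
proof (rule ccontr)
  assume "\<not> negligible E"
  define m where "m = measure lebesgue E"
  have m: "0 < m"
    using E \<open>\<not> negligible E\<close> measure_nonneg[of lebesgue E]
    by (auto simp: m_def negligible_iff_measure less_le)
  define e where "e = (q - p) * m / 4"
  have e: "0 < e" using m pq by (simp add: e_def)
  obtain d0 where d0: "0 < d0" and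
    ac': "\<And>P. interval_packing {l..u} P \<Longrightarrow> total_length P < d0 \<Longrightarrow> (\<Sum>(s, t)\<in>P. \<bar>f t - f s\<bar>) < e"
    using abs_continuous_on_packing[OF ac e] by blast
  \<comment> \<open>The three bounds on \<open>d\<close> serve absolute continuity, the length of the flat part, and the estimate
    of \<open>q\<close> times the length of the gaps.\<close>
  define d where "d = min d0 (min (m / 8) ((q - p) * m / (8 * (\<bar>q\<bar> + 1))))"
  have d: "0 < d" using d0 m pq by (simp add: d_def)
  obtain T where T: "open T" "E \<subseteq> T" "T - E \<in> lmeasurable" "emeasure lebesgue (T - E) < ennreal (d / 2)"
    using sets_lebesgue_outer_open[of E "d / 2"] E d by auto
  define U where "U = T \<inter> {l<..<u}"
  have U: "open U" "E \<subseteq> U" "U \<subseteq> {l..u}" using T E by (auto simp: U_def)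
  have rest: "measure lebesgue (U - E) < d / 2"
  proof -
    have "measure lebesgue (T - E) < d / 2"
      using T d by (simp add: emeasure_eq_measure2 ennreal_less_iff)
    moreover have "measure lebesgue (U - E) \<le> measure lebesgue (T - E)"
      using T E U by (intro measure_mono_fmeasurable) (auto simp: U_def)
    ultimately show ?thesis by simp
  qed
  obtain P where P: "interval_packing U P" and Pq: "\<And>s t. (s, t) \<in> P \<Longrightarrow> q * (t - s) < f t - f s"
    and Pm: "m - m / 8 < total_length P"
    using Vitali_interval_packing[OF E(1) U(2) U(1) high, of "m / 8"] m by (auto simp: m_def)
  have finP: "finite P" using P by (simp add: interval_packing_def)
  \<comment> \<open>Half of \<open>d\<close> is allotted to the part of the open set outside \<open>E\<close>, the other half is
    distributed over the members of \<open>P\<close>; the added 1 only keeps the denominator positive.\<close>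
  define r where "r = d / (2 * (card P + 1))"
  have r: "0 < r" using d by (simp add: r_def)
  have "\<exists>F G. interval_packing {fst I..snd I} F \<and> interval_packing {fst I..snd I} G \<and>
      increment f F \<le> p * total_length F \<and>
      total_length G \<le> measure lebesgue ({fst I<..<snd I} - E) + r \<and>
      (\<forall>h. increment h F + increment h G = h (snd I) - h (fst I))"
    if I: "I \<in> P" for I
  proof -
    obtain s t where st: "I = (s, t)" by (cases I)
    have "s < t" using st I P by (auto simp: interval_packing_iff)
    have ES: "E \<inter> {s<..<t} \<in> lmeasurable" using E by (intro fmeasurable_Int_fmeasurable) auto
    have lm: "\<exists>u v. u < x \<and> x < v \<and> v - u < d \<and> f v - f u < p * (v - u)"
      if "x \<in> E \<inter> {s<..<t}" "0 < d" for x d using low that by blast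
    obtain F where F: "interval_packing {s<..<t} F"
      and Fp: "\<And>s t. (s, t) \<in> F \<Longrightarrow> f t - f s < p * (t - s)"
      and Fm: "measure lebesgue (E \<inter> {s<..<t}) - r < total_length F"
      using Vitali_interval_packing[OF ES _ _ lm r, of "{s<..<t}"] by auto
    have F': "interval_packing {s..t} F" by (rule interval_packing_mono[OF F]) auto
    then obtain G where G: "interval_packing {s..t} G"
      and FG: "\<And>h. increment h F + increment h G = h t - h s"
      using complementary_packing[OF F'] \<open>s < t\<close> by auto
    have "increment f F \<le> p * total_length F"
      unfolding increment_def sum_distrib_left
      by (intro sum_mono) (use Fp in \<open>auto intro: less_imp_le\<close>)
    moreover have "total_length G \<le> measure lebesgue ({s<..<t} - E) + r"
    proof -
      have "measure lebesgue ({s<..<t} - E) = measure lebesgue {s<..<t} - measure lebesgue (E \<inter> {s<..<t})"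
      proof -
        have "{s<..<t} - E = {s<..<t} - E \<inter> {s<..<t}" by auto
        then show ?thesis using ES by (simp add: measurable_measure_Diff fmeasurableD)
      qed
      then show ?thesis using FG[of "\<lambda>x. x"] Fm \<open>s < t\<close> by simp
    qed
    ultimately show ?thesis unfolding st fst_conv snd_conv using F' G FG by blast
  qed
  then have "\<forall>I\<in>P. \<exists>F G. interval_packing {fst I..snd I} F \<and> interval_packing {fst I..snd I} G \<and>
      increment f F \<le> p * total_length F \<and>
      total_length G \<le> measure lebesgue ({fst I<..<snd I} - E) + r \<and>
      (\<forall>h. increment h F + increment h G = h (snd I) - h (fst I))" by blast
  then obtain F G where FG: "\<forall>I\<in>P. interval_packing {fst I..snd I} (F I) \<and>
      interval_packing {fst I..snd I} (G I) \<and>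
      increment f (F I) \<le> p * total_length (F I) \<and>
      total_length (G I) \<le> measure lebesgue ({fst I<..<snd I} - E) + r \<and>
      (\<forall>h. increment h (F I) + increment h (G I) = h (snd I) - h (fst I))"
    unfolding bchoice_iff by blast
  define GG where "GG = (\<Union>I\<in>P. G I)"
  have PU: "interval_packing {l..u} P" by (rule interval_packing_mono[OF P U(3)])
  have GG: "interval_packing {l..u} GG" and incGG: "increment h GG = (\<Sum>I\<in>P. increment h (G I))" for h
    unfolding GG_def using FG
    by (auto intro!: interval_packing_UN[OF PU])
  define L where "L = (\<Sum>I\<in>P. total_length (F I))"
  have split: "increment h P = (\<Sum>I\<in>P. increment h (F I)) + increment h GG" for h
    unfolding incGG increment_def[of h P] sum.distrib[symmetric]
    by (rule sum.cong) (use FG in \<open>auto simp: case_prod_beta\<close>)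
  have "total_length GG \<le> (\<Sum>I\<in>P. measure lebesgue ({fst I<..<snd I} - E) + r)"
    unfolding incGG by (intro sum_mono) (use FG in blast)
  also have "\<dots> = measure lebesgue (\<Union>I\<in>P. {fst I<..<snd I} - E) + card P * r"
  proof -
    have "disjoint_family_on (\<lambda>I. {fst I<..<snd I} - E) P"
      using P unfolding disjoint_family_on_def interval_packing_def pairwise_def disjnt_def by fastforce
    then show ?thesis
      using E finP by (subst measure_finite_Union)
        (auto simp: sum.distrib intro!: fmeasurableD2 fmeasurable_Diff)
  qed
  also have "measure lebesgue (\<Union>I\<in>P. {fst I<..<snd I} - E) \<le> measure lebesgue (U - E)"
  proof (rule measure_mono_fmeasurable)
    show "(\<Union>I\<in>P. {fst I<..<snd I} - E) \<subseteq> U - E" using P by (fastforce simp: interval_packing_def)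
    show "U - E \<in> lmeasurable"
    proof (rule fmeasurableI2[OF T(3)])
      show "U - E \<in> sets lebesgue" using U(1) by (intro sets.Diff fmeasurableD[OF E(1)]) auto
    qed (auto simp: U_def)
  qed (use E finP in \<open>auto intro!: fmeasurableD\<close>)
  also have "card P * r \<le> d / 2"
    using d unfolding r_def by (simp add: field_simps)
  finally have lenGG: "total_length GG < d" using rest by simp
  have "\<bar>increment f GG\<bar> < e"
    using ac'[OF GG] lenGG abs_increment_le[of f GG] by (simp add: d_def)
  then have "increment f P \<le> p * L + e"
    using sum_mono[of P "\<lambda>I. increment f (F I)" "\<lambda>I. p * total_length (F I)"] FG
    by (simp add: split L_def sum_distrib_left)
  moreover have "q * total_length P \<le> increment f P"
    unfolding increment_def sum_distrib_left
    by (intro sum_mono) (use Pq in \<open>auto intro: less_imp_le\<close>)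
  moreover have tot: "total_length P = L + total_length GG"
    by (simp add: split L_def)
  ultimately have "(q - p) * L + q * total_length GG \<le> e" by (simp add: algebra_simps)
  moreover have GG0: "0 \<le> total_length GG" by (rule total_length_nonneg[OF GG])
  have "- ((q - p) * m / 8) \<le> q * total_length GG"
  proof -
    have "\<bar>q * total_length GG\<bar> \<le> (\<bar>q\<bar> + 1) * d"
      using lenGG GG0 by (simp add: abs_mult mult_mono)
    also have "\<dots> \<le> (\<bar>q\<bar> + 1) * ((q - p) * m / (8 * (\<bar>q\<bar> + 1)))"
      by (intro mult_left_mono) (auto simp: d_def)
    also have "\<dots> = (q - p) * m / 8" by (simp add: field_simps)
    finally show ?thesis by linarith
  qed
  moreover have "3 * m / 4 \<le> L" using Pm tot lenGG d_def by linarith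
  then have "(q - p) * (3 * m / 4) \<le> (q - p) * L" using pq by (intro mult_left_mono) auto
  ultimately have "(q - p) * (3 * m / 4) - (q - p) * m / 8 \<le> (q - p) * m / 4"
    unfolding e_def by linarith
  moreover have "0 < (q - p) * m" using pq m by simp
  ultimately show False by (simp add: field_simps)
qed

text \<open>
  Within an interval shorter than the \<open>d\<close> that absolute continuity supplies for \<open>e = 1\<close>, total
  increments stay below 1, whereas intervals of slope above \<open>2 / m\<close> that fill half of a set of measure
  \<open>m\<close> have total increment above 1.
\<close>

lemma unbounded_slopes_negligible:
  assumes ac: "abs_continuous_on {l..u} f"
    and E: "E \<in> lmeasurable" "E \<subseteq> {l<..<u}"
    and high: "\<And>x d q. x \<in> E \<Longrightarrow> 0 < d \<Longrightarrow> \<exists>s t. s < x \<and> x < t \<and> t - s < d \<and> q * (t - s) < f t - f s"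
  shows "negligible E"
proof -
  obtain d where d: "0 < d" and
    ac': "\<And>P. interval_packing {l..u} P \<Longrightarrow> total_length P < d \<Longrightarrow> (\<Sum>(s, t)\<in>P. \<bar>f t - f s\<bar>) < 1"
    using abs_continuous_on_packing[OF ac zero_less_one] by blast
  have neg: "negligible (E \<inter> {a<..<a + d / 2})" for a
  proof (rule ccontr)
    assume nneg: "\<not> negligible (E \<inter> {a<..<a + d / 2})"
    define E' where "E' = E \<inter> {a<..<a + d / 2}"
    have E': "E' \<in> lmeasurable" using E by (auto simp: E'_def intro!: fmeasurable_Int_fmeasurable)
    define m where "m = measure lebesgue E'"
    have m: "0 < m"
      using E' nneg measure_nonneg[of lebesgue E']
      by (auto simp: m_def E'_def negligible_iff_measure less_le)
    define U where "U = {l<..<u} \<inter> {a<..<a + d / 2}"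
    have high': "\<exists>s t. s < x \<and> x < t \<and> t - s < d \<and> 2 / m * (t - s) < f t - f s"
      if "x \<in> E'" "0 < d" for x d using high[of x d "2 / m"] that unfolding E'_def by blast
    obtain P where P: "interval_packing U P" and Pq: "\<And>s t. (s, t) \<in> P \<Longrightarrow> 2 / m * (t - s) < f t - f s"
      and Pm: "m - m / 2 < total_length P"
    proof (rule Vitali_interval_packing[OF E' _ _ high', of U "m / 2"])
      show "E' \<subseteq> U" "open U" using E by (auto simp: E'_def U_def)
    qed (use m in \<open>auto simp: m_def\<close>)
    have "total_length P \<le> measure lebesgue {a<..<a + d / 2}"
      by (rule total_length_le_measure[OF interval_packing_mono[OF P]]) (auto simp: U_def)
    then have "total_length P < d" using d by simp
    moreover have "interval_packing {l..u} P" by (rule interval_packing_mono[OF P]) (auto simp: U_def)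
    ultimately have "(\<Sum>(s, t)\<in>P. \<bar>f t - f s\<bar>) < 1" by (rule ac'[rotated])
    moreover have "2 / m * total_length P \<le> increment f P"
      unfolding increment_def sum_distrib_left
      by (intro sum_mono) (use Pq in \<open>auto intro: less_imp_le\<close>)
    moreover have "1 < 2 / m * total_length P" using Pm m by (simp add: field_simps)
    ultimately show False using abs_increment_le[of f P] by linarith
  qed
  have "E \<subseteq> (\<Union>k::int. E \<inter> {k * (d / 4)<..<k * (d / 4) + d / 2})"
  proof
    fix x assume x: "x \<in> E"
    define k where "k = \<lceil>x / (d / 4)\<rceil> - 1"
    have "k < x / (d / 4)" "x / (d / 4) \<le> k + 1" unfolding k_def by linarith+
    then have "k * (d / 4) < x" "x \<le> (k + 1) * (d / 4)"
      using d by (simp_all add: pos_less_divide_eq pos_divide_le_eq)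
    then have "x \<in> {k * (d / 4)<..<k * (d / 4) + d / 2}" using d by (simp add: algebra_simps)
    with x show "x \<in> (\<Union>k::int. E \<inter> {k * (d / 4)<..<k * (d / 4) + d / 2})" by blast
  qed
  moreover have "negligible (\<Union>k::int. E \<inter> {k * (d / 4)<..<k * (d / 4) + d / 2})"
    by (intro negligible_countable_Union) (auto simp: neg)
  ultimately show ?thesis by (rule negligible_subset[rotated])
qed

text \<open>
  For continuous \<open>f\<close>, these are the points where the upper derivative exceeds \<open>q\<close>, and possibly some
  where it equals \<open>q\<close>. The intervals are open and contain the point in their interior, which makes the set a countable intersection of
  open sets and hence measurable.
\<close>

definition steep_points :: "(real \<Rightarrow> real) \<Rightarrow> real \<Rightarrow> real set" where
  "steep_points f q =
     (\<Inter>n::nat. \<Union>{{s<..<t} |s t. t - s < inverse (Suc n) \<and> q * (t - s) < f t - f s})"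

lemma steep_points_borel [measurable]: "steep_points f q \<in> sets borel"
  unfolding steep_points_def
  by (intro sets.countable_INT) (auto intro!: borel_open open_Union)

lemma steep_points_iff:
  "x \<in> steep_points f q \<longleftrightarrow> (\<forall>d>0. \<exists>s t. s < x \<and> x < t \<and> t - s < d \<and> q * (t - s) < f t - f s)"
proof
  assume x: "x \<in> steep_points f q"
  show "\<forall>d>0. \<exists>s t. s < x \<and> x < t \<and> t - s < d \<and> q * (t - s) < f t - f s"
  proof (intro allI impI)
    fix d :: real assume "0 < d"
    then obtain n where n: "inverse (real (Suc n)) < d" using reals_Archimedean by blast
    obtain s t where "x \<in> {s<..<t}" "t - s < inverse (Suc n)" "q * (t - s) < f t - f s"
      using x unfolding steep_points_def by blast
    with n show "\<exists>s t. s < x \<and> x < t \<and> t - s < d \<and> q * (t - s) < f t - f s"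
      by (intro exI[of _ s] exI[of _ t]) auto
  qed
next
  assume R: "\<forall>d>0. \<exists>s t. s < x \<and> x < t \<and> t - s < d \<and> q * (t - s) < f t - f s"
  show "x \<in> steep_points f q"
    unfolding steep_points_def
  proof (rule INT_I)
    fix n :: nat
    have "0 < inverse (real (Suc n))" by simp
    with R obtain s t where st: "s < x" "x < t" "t - s < inverse (real (Suc n))" "q * (t - s) < f t - f s"
      by blast
    show "x \<in> \<Union>{{s<..<t} |s t. t - s < inverse (Suc n) \<and> q * (t - s) < f t - f s}"
      by (rule UnionI[of "{s<..<t}"]) (use st in auto)
  qed
qed

text \<open>
  A difference quotient at \<open>x\<close> belongs to an interval with \<open>x\<close> as an endpoint. By continuity
  that endpoint can be moved past \<open>x\<close> without losing the strict bound on the slope.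
\<close>

lemma frequently_steep:
  assumes cont: "isCont f x" and freq: "\<exists>\<^sub>F y in at x. q < (f y - f x) / (y - x)"
  shows "x \<in> steep_points f q"
  unfolding steep_points_iff
proof (intro allI impI)
  fix d :: real assume d: "0 < d"
  have "\<exists>\<^sub>F y in at x. q < (f y - f x) / (y - x) \<and> (y \<noteq> x \<and> \<bar>y - x\<bar> < d / 2)"
  proof (rule frequently_rev_mp[OF freq])
    show "\<forall>\<^sub>F y in at x. q < (f y - f x) / (y - x) \<longrightarrow>
        q < (f y - f x) / (y - x) \<and> (y \<noteq> x \<and> \<bar>y - x\<bar> < d / 2)"
      using d by (auto simp: eventually_at dist_real_def intro!: exI[of _ "d / 2"])
  qed
  then obtain y where y: "q < (f y - f x) / (y - x)" "y \<noteq> x" "\<bar>y - x\<bar> < d / 2"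
    by (auto dest: frequently_ex)
  show "\<exists>s t. s < x \<and> x < t \<and> t - s < d \<and> q * (t - s) < f t - f s"
  proof (cases "x < y")
    case True
    have "((\<lambda>z. f y - f z - q * (y - z)) \<longlongrightarrow> f y - f x - q * (y - x)) (at_left x)"
      using cont by (intro tendsto_intros) (auto simp: isCont_def intro: tendsto_within_subset)
    moreover have "0 < f y - f x - q * (y - x)" using y True by (simp add: field_simps)
    ultimately have "\<forall>\<^sub>F z in at_left x. 0 < f y - f z - q * (y - z)" by (rule order_tendstoD(1))
    moreover have "\<forall>\<^sub>F z in at_left x. z \<in> {x - d / 2<..<x}"
      using d by (intro eventually_at_left_real) auto
    ultimately have "\<forall>\<^sub>F z in at_left x. z \<in> {x - d / 2<..<x} \<and> 0 < f y - f z - q * (y - z)"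
      by eventually_elim auto
    then obtain z where "z \<in> {x - d / 2<..<x}" "0 < f y - f z - q * (y - z)"
      using eventually_happens[of _ "at_left x"] trivial_limit_at_left_real by blast
    then show ?thesis using y True by (intro exI[of _ z] exI[of _ y]) auto
  next
    case False
    have "((\<lambda>z. f z - f y - q * (z - y)) \<longlongrightarrow> f x - f y - q * (x - y)) (at_right x)"
      using cont by (intro tendsto_intros) (auto simp: isCont_def intro: tendsto_within_subset)
    moreover have "0 < f x - f y - q * (x - y)" using y False by (simp add: field_simps)
    ultimately have "\<forall>\<^sub>F z in at_right x. 0 < f z - f y - q * (z - y)" by (rule order_tendstoD(1))
    moreover have "\<forall>\<^sub>F z in at_right x. z \<in> {x<..<x + d / 2}"
      using d by (intro eventually_at_right_real) auto
    ultimately have "\<forall>\<^sub>F z in at_right x. z \<in> {x<..<x + d / 2} \<and> 0 < f z - f y - q * (z - y)"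
      by eventually_elim auto
    then obtain z where "z \<in> {x<..<x + d / 2}" "0 < f z - f y - q * (z - y)"
      using eventually_happens[of _ "at_right x"] trivial_limit_at_right_real by blast
    then show ?thesis using y False by (intro exI[of _ y] exI[of _ z]) auto
  qed
qed

text \<open>
  The lower and upper limits \<open>L \<le> H\<close> of the difference quotients decide: if they agree and are finite,
  then they are the derivative; if they agree and are infinite, then the slopes are unbounded in one
  direction; otherwise two rational numbers separate them. Rational numbers make the resulting family of
  exceptional sets countable.
\<close>

lemma not_differentiable_steep:
  assumes cont: "isCont f x" and nd: "\<not> f field_differentiable (at x)"
  shows "(\<exists>p q::rat. p < q \<and> x \<in> steep_points f (of_rat q) \<and> x \<in> steep_points (\<lambda>x. - f x) (- of_rat p)) \<or>
    (\<forall>q. x \<in> steep_points f q) \<or> (\<forall>q. x \<in> steep_points (\<lambda>x. - f x) q)"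
proof -
  define S where "S = (\<lambda>y. (f y - f x) / (y - x))"
  define L H where "L = Liminf (at x) (\<lambda>y. ereal (S y))" and "H = Limsup (at x) (\<lambda>y. ereal (S y))"
  have LH: "L \<le> H" unfolding L_def H_def by (intro Liminf_le_Limsup) simp
  have up: "x \<in> steep_points f q" if "ereal q < H" for q
  proof (rule frequently_steep[OF cont], rule ccontr)
    assume "\<not> (\<exists>\<^sub>F y in at x. q < (f y - f x) / (y - x))"
    then have "\<forall>\<^sub>F y in at x. ereal (S y) \<le> ereal q"
      by (simp add: frequently_def S_def not_less)
    then have "H \<le> ereal q" unfolding H_def by (rule Limsup_bounded)
    with that show False by simp
  qed
  have low: "x \<in> steep_points (\<lambda>x. - f x) (- p)" if "L < ereal p" for p
  proof (rule frequently_steep, use cont in simp, rule ccontr)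
    assume "\<not> (\<exists>\<^sub>F y in at x. - p < (- f y - - f x) / (y - x))"
    moreover have "(- f y - - f x) / (y - x) = - S y" for y
      by (simp add: S_def diff_divide_distrib)
    ultimately have "\<forall>\<^sub>F y in at x. ereal p \<le> ereal (S y)"
      by (simp add: frequently_def not_less)
    then have "ereal p \<le> L" unfolding L_def by (rule Liminf_bounded)
    with that show False by simp
  qed
  show ?thesis
  proof (cases "L = H")
    case False
    with LH have "L < H" by simp
    then obtain p where p: "L < ereal (of_rat p)" "ereal (of_rat p) < H" using ereal_dense3 by blast
    then obtain q where q: "ereal (of_rat p) < ereal (of_rat q)" "ereal (of_rat q) < H"
      using ereal_dense3 by blast
    then have "p < q" by (simp add: of_rat_less)
    with p q up low show ?thesis by blast
  next
    case True
    show ?thesis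
    proof (cases H)
      case (real c)
      with True have "((\<lambda>y. ereal (S y)) \<longlongrightarrow> ereal c) (at x)"
        by (subst tendsto_iff_Liminf_eq_Limsup) (auto simp: L_def H_def)
      then have "(S \<longlongrightarrow> c) (at x)" by simp
      then have "(f has_field_derivative c) (at x)" by (simp add: has_field_derivative_iff S_def)
      with nd show ?thesis by (auto simp: field_differentiable_def)
    next
      case PInf
      then show ?thesis using up by simp
    next
      case MInf
      then have "x \<in> steep_points (\<lambda>x. - f x) q" for q using low[of "- q"] True by simp
      then show ?thesis by simp
    qed
  qed
qed



lemma abs_continuous_on_uminus:
  "abs_continuous_on S f \<Longrightarrow> abs_continuous_on S (\<lambda>x. - f x)"
  by (simp add: abs_continuous_on_def abs_minus_commute)

lemma negligible_not_differentiable: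
  assumes ac: "abs_continuous_on {l..u} f"
  shows "negligible {x \<in> {l..u}. \<not> f field_differentiable (at x)}"
proof -
  define g where "g = (\<lambda>x. - f x)"
  have acg: "abs_continuous_on {l..u} g" unfolding g_def by (rule abs_continuous_on_uminus[OF ac])
  have lm: "S \<inter> {l<..<u} \<in> lmeasurable" if "S \<in> sets borel" for S
    using fmeasurable_Int_fmeasurable[of "{l<..<u}" lebesgue S] that by (simp add: Int_commute)
  define A where "A = (\<lambda>(p::rat, q::rat).
    if p < q then steep_points f (of_rat q) \<inter> steep_points g (- of_rat p) \<inter> {l<..<u} else {})"
  have A: "negligible (A pq)" for pq
  proof -
    obtain p q where pq: "pq = (p, q)" by (cases pq)
    have "negligible (steep_points f (of_rat q) \<inter> steep_points g (- of_rat p) \<inter> {l<..<u})" if "p < q"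
    proof (rule straddled_slopes_negligible[OF ac, where p = "of_rat p" and q = "of_rat q"])
      fix x d :: real assume *: "x \<in> steep_points f (of_rat q) \<inter> steep_points g (- of_rat p) \<inter> {l<..<u}" "0 < d"
      then show "\<exists>s t. s < x \<and> x < t \<and> t - s < d \<and> of_rat q * (t - s) < f t - f s"
        by (simp add: steep_points_iff)
      from * obtain s t where "s < x" "x < t" "t - s < d" "- of_rat p * (t - s) < g t - g s"
        unfolding Int_iff steep_points_iff by blast
      then show "\<exists>s t. s < x \<and> x < t \<and> t - s < d \<and> f t - f s < of_rat p * (t - s)"
        by (intro exI[of _ s] exI[of _ t]) (simp add: g_def)
    qed (use that in \<open>auto intro!: lm simp: of_rat_less\<close>)
    then show ?thesis by (simp add: A_def pq)
  qed
  define B where "B = (\<lambda>h::real \<Rightarrow> real. (\<Inter>n::nat. steep_points h n) \<inter> {l<..<u})"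
  have B: "negligible (B h)" if "abs_continuous_on {l..u} h" for h
  proof (rule unbounded_slopes_negligible[OF that])
    show "B h \<in> lmeasurable" unfolding B_def by (intro lm sets.countable_INT) auto
    fix x d q :: real assume x: "x \<in> B h" and d: "0 < d"
    obtain n :: nat where n: "q \<le> n" using real_arch_simple by blast
    from x d obtain s t where st: "s < x" "x < t" "t - s < d" "real n * (t - s) < h t - h s"
      unfolding B_def Int_iff INT_iff steep_points_iff by blast
    have "q * (t - s) \<le> real n * (t - s)" using st n by (intro mult_right_mono) auto
    with st have "q * (t - s) < h t - h s" by linarith
    with st show "\<exists>s t. s < x \<and> x < t \<and> t - s < d \<and> q * (t - s) < h t - h s"
      by blast
  qed (auto simp: B_def)
  have "{x \<in> {l..u}. \<not> f field_differentiable (at x)} \<subseteq> (\<Union>pq. A pq) \<union> B f \<union> B g \<union> {l, u}"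
  proof (rule subsetI, rule ccontr)
    fix x assume "x \<in> {x \<in> {l..u}. \<not> f field_differentiable (at x)}"
      and notin: "x \<notin> (\<Union>pq. A pq) \<union> B f \<union> B g \<union> {l, u}"
    then have x: "x \<in> {l..u}" "\<not> f field_differentiable (at x)" "x \<notin> {l, u}" "x \<notin> B g" "x \<notin> B f"
      by auto
    then have xin: "x \<in> {l<..<u}" by auto
    have "isCont f x"
      using abs_continuous_on_imp_continuous_on[OF ac] xin
      by (metis continuous_on_interior interior_atLeastAtMost_real)
    from not_differentiable_steep[OF this x(2)]
    consider p q :: rat where "p < q" "x \<in> steep_points f (of_rat q)" "x \<in> steep_points g (- of_rat p)"
      | "\<forall>q. x \<in> steep_points f q" | "\<forall>q. x \<in> steep_points g q"
      unfolding g_def by blast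
    then obtain p q :: rat where "p < q" "x \<in> steep_points f (of_rat q)" "x \<in> steep_points g (- of_rat p)"
      using x(4,5) xin by cases (auto simp: B_def)
    then have "x \<in> A (p, q)" using xin by (simp add: A_def)
    then show False using notin by blast
  qed
  moreover have "negligible ((\<Union>pq. A pq) \<union> B f \<union> B g \<union> {l, u})"
    by (intro negligible_Un negligible_countable_Union) (auto simp: A B ac acg)
  ultimately show ?thesis by (rule negligible_subset[rotated])
qed

section \<open>The fundamental theorem for absolutely continuous functions\<close>

text \<open>
  The integral is in the sense of Henstock and Kurzweil, where no integrability of the derivative has to
  be known in advance.
\<close>

theorem abs_continuous_on_FTC:
  assumes ac: "abs_continuous_on {l..u} f" and lu: "l \<le> u"
  shows "(deriv f has_integral (f u - f l)) {l..u}"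
proof -
  define N where "N = {x \<in> {l..u}. \<not> f field_differentiable (at x)}"
  have N: "negligible N" unfolding N_def by (rule negligible_not_differentiable[OF ac])
  define k where "k = (\<lambda>x. if x \<in> N then 0 else deriv f x)"
  have "(k has_integral (f u - f l)) (cbox l u)"
    unfolding has_integral
  proof (intro allI impI)
    fix e :: real assume e: "0 < e"
    define e' where "e' = e / (2 * (u - l + 1))"
    have e': "0 < e'" using e lu by (simp add: e'_def)
    obtain d where d: "0 < d" and
      ac': "\<And>P. interval_packing {l..u} P \<Longrightarrow> total_length P < d \<Longrightarrow> (\<Sum>(s, t)\<in>P. \<bar>f t - f s\<bar>) < e / 2"
      using abs_continuous_on_packing[OF ac, of "e / 2"] e by auto
    obtain T where T: "open T" "N \<subseteq> T" "T - N \<in> lmeasurable" "emeasure lebesgue (T - N) < ennreal d"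
      using sets_lebesgue_outer_open[of N d] N d by (auto simp: negligible_iff_null_sets)
    have Tm: "T \<in> lmeasurable" "measure lebesgue T < d"
    proof -
      have "T = (T - N) \<union> N" using T by auto
      then have *: "T \<in> lmeasurable"
        using T(3) N by (metis fmeasurable.Un negligible_imp_measurable)
      show "T \<in> lmeasurable" by fact
      have "measure lebesgue T = measure lebesgue (T - N)"
        using N * by (simp add: measure_Diff_null_set negligible_iff_null_sets fmeasurableD)
      also have "\<dots> < d" using T d by (simp add: emeasure_eq_measure2 ennreal_less_iff)
      finally show "measure lebesgue T < d" .
    qed
    have "\<exists>r>0. \<forall>y. \<bar>y - x\<bar> < r \<longrightarrow> \<bar>f y - f x - deriv f x * (y - x)\<bar> \<le> e' * \<bar>y - x\<bar>"
      if "x \<in> {l..u} - N" for x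
    proof -
      have "(f has_field_derivative deriv f x) (at x)"
        using that by (auto simp: N_def DERIV_deriv_iff_field_differentiable)
      then show ?thesis
        using e' unfolding has_field_derivative_def has_derivative_at_alt by auto
    qed
    then have "\<forall>x\<in>{l..u} - N. \<exists>r>0. \<forall>y. \<bar>y - x\<bar> < r \<longrightarrow> \<bar>f y - f x - deriv f x * (y - x)\<bar> \<le> e' * \<bar>y - x\<bar>"
      by blast
    then obtain r where r: "\<forall>x\<in>{l..u} - N. 0 < r x \<and>
        (\<forall>y. \<bar>y - x\<bar> < r x \<longrightarrow> \<bar>f y - f x - deriv f x * (y - x)\<bar> \<le> e' * \<bar>y - x\<bar>)"
      unfolding bchoice_iff by blast
    \<comment> \<open>An interval tagged in \<open>N\<close> is forced into \<open>T\<close>, so that such intervals have total length below \<open>d\<close>.\<close>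
    define \<gamma> where "\<gamma> = (\<lambda>x. if x \<in> N then T else if x \<in> {l..u} then ball x (r x) else UNIV)"
    have gauge: "gauge \<gamma>" using T r by (auto simp: gauge_def \<gamma>_def)
    have fine: "norm ((\<Sum>(x, K)\<in>D. measure lborel K *\<^sub>R k x) - (f u - f l)) < e"
      if D: "D tagged_division_of cbox l u" "\<gamma> fine D" for D
    proof -
      have finD: "finite D" using D by blast
      have DK: "\<exists>s t. K = {s..t} \<and> l \<le> s \<and> s \<le> x \<and> x \<le> t \<and> t \<le> u \<and> Inf K = s \<and> Sup K = t \<and> K \<subseteq> \<gamma> x"
        if xK: "(x, K) \<in> D" for x K
      proof -
        obtain s t where K: "K = {s..t}" using tagged_division_ofD(4)[OF D(1) xK] by auto
        moreover have "x \<in> K" "K \<subseteq> {l..u}" using tagged_division_ofD(2,3)[OF D(1) xK] by auto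
        moreover have "K \<subseteq> \<gamma> x" using D(2) xK by (auto simp: fine_def)
        ultimately show ?thesis by (intro exI[of _ s] exI[of _ t]) auto
      qed
      \<comment> \<open>Degenerate intervals contribute no error, and they have to be left out of \<open>Z\<close>: without them
        the endpoints determine the interval, so the intervals in \<open>Z\<close> become a packing.\<close>
      define G where "G = {(x, K)\<in>D. x \<notin> N}"
      define Z where "Z = {(x, K)\<in>D. x \<in> N \<and> Inf K < Sup K}"
      define err where "err = (\<lambda>(x, K). measure lborel K *\<^sub>R k x - (f (Sup K) - f (Inf K)))"
      have fin: "finite G" "finite Z" by (auto simp: G_def Z_def intro: finite_subset[OF _ finD])
      have tele: "f u - f l = (\<Sum>(x, K)\<in>D. f (Sup K) - f (Inf K))"
        using additive_tagged_division_1[OF lu, of D f] D by simp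
      have "(\<Sum>(x, K)\<in>D. measure lborel K *\<^sub>R k x) - (f u - f l) = (\<Sum>I\<in>D. err I)"
        unfolding tele err_def by (simp add: sum_subtractf[symmetric] case_prod_beta)
      also have "\<dots> = (\<Sum>I\<in>G \<union> Z. err I)"
      proof (rule sum.mono_neutral_right[OF finD])
        show "G \<union> Z \<subseteq> D" by (auto simp: G_def Z_def)
        show "\<forall>I\<in>D - (G \<union> Z). err I = 0"
        proof
          fix I assume I: "I \<in> D - (G \<union> Z)"
          obtain x K where xI: "I = (x, K)" by (cases I)
          with I have xK: "(x, K) \<in> D" "(x, K) \<notin> G \<union> Z" by auto
          from DK[OF xK(1)] obtain s t where K: "K = {s..t}" "s \<le> t" "Inf K = s" "Sup K = t" by auto
          with xK have "s = t" by (auto simp: G_def Z_def)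
          with K show "err I = 0" by (simp add: err_def xI)
        qed
      qed
      also have "\<dots> = (\<Sum>I\<in>G. err I) + (\<Sum>I\<in>Z. err I)"
        using fin by (intro sum.union_disjoint) (auto simp: G_def Z_def)
      finally have eq: "(\<Sum>(x, K)\<in>D. measure lborel K *\<^sub>R k x) - (f u - f l) = (\<Sum>I\<in>G. err I) + (\<Sum>I\<in>Z. err I)" .
      have "\<bar>\<Sum>I\<in>G. err I\<bar> \<le> (\<Sum>I\<in>G. e' * measure lborel (snd I))"
      proof (rule order_trans[OF sum_abs], rule sum_mono)
        fix I assume I: "I \<in> G"
        then obtain x K where xK: "I = (x, K)" "(x, K) \<in> D" "x \<notin> N" by (auto simp: G_def)
        from DK[OF xK(2)] obtain s t where K: "K = {s..t}" "l \<le> s" "s \<le> x" "x \<le> t" "t \<le> u"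
          "Inf K = s" "Sup K = t" "K \<subseteq> \<gamma> x" by auto
        have "x \<in> {l..u} - N" using K xK by auto
        with r have rx: "\<And>y. \<bar>y - x\<bar> < r x \<Longrightarrow> \<bar>f y - f x - deriv f x * (y - x)\<bar> \<le> e' * \<bar>y - x\<bar>"
          by blast
        have "{s..t} \<subseteq> ball x (r x)" using K xK by (auto simp: \<gamma>_def)
        moreover have "s \<in> {s..t}" "t \<in> {s..t}" using K by auto
        ultimately have "s \<in> ball x (r x)" "t \<in> ball x (r x)" by blast+
        then have *: "\<bar>f s - f x - deriv f x * (s - x)\<bar> \<le> e' * (x - s)"
          "\<bar>f t - f x - deriv f x * (t - x)\<bar> \<le> e' * (t - x)"
          using rx[of s] rx[of t] K by (auto simp: dist_real_def)
        have "err I = (f s - f x - deriv f x * (s - x)) - (f t - f x - deriv f x * (t - x))"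
          using K xK by (simp add: err_def k_def algebra_simps)
        also have "\<bar>\<dots>\<bar> \<le> e' * (x - s) + e' * (t - x)" using * by linarith
        also have "\<dots> = e' * measure lborel (snd I)" using K xK by (simp add: algebra_simps)
        finally show "\<bar>err I\<bar> \<le> e' * measure lborel (snd I)" .
      qed
      also have "\<dots> \<le> (\<Sum>I\<in>D. e' * measure lborel (snd I))"
        using e' by (intro sum_mono2[OF finD]) (auto simp: G_def)
      also have "\<dots> = e' * (u - l)"
        using additive_content_tagged_division[OF D(1)] lu
        by (simp add: sum_distrib_left[symmetric] case_prod_beta)
      also have "\<dots> < e / 2"
        using e lu by (simp add: e'_def field_simps)
      finally have Gle: "\<bar>\<Sum>I\<in>G. err I\<bar> < e / 2" .
      define ends where "ends = (\<lambda>I::real \<times> real set. (Inf (snd I), Sup (snd I)))"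
      have ZP: "\<exists>x s t. I = (x, {s..t}) \<and> (x, {s..t}) \<in> D \<and> x \<in> N \<and> s < t \<and> l \<le> s \<and> t \<le> u \<and>
          {s..t} \<subseteq> T \<and> ends I = (s, t)" if IZ: "I \<in> Z" for I
      proof -
        obtain x K where I: "I = (x, K)" by (cases I)
        with IZ have xK: "(x, K) \<in> D" "x \<in> N" "Inf K < Sup K" by (simp_all add: Z_def)
        from DK[OF xK(1)] obtain s t where "K = {s..t}" "l \<le> s" "s \<le> x" "x \<le> t" "t \<le> u"
          "Inf K = s" "Sup K = t" "K \<subseteq> \<gamma> x" by auto
        with I xK show ?thesis by (intro exI[of _ x] exI[of _ s] exI[of _ t]) (simp add: ends_def \<gamma>_def)
      qed
      have dis: "disjnt {s<..<t} {s'<..<t'}"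
        if "I \<in> Z" "J \<in> Z" "I \<noteq> J" "ends I = (s, t)" "ends J = (s', t')" for I J s t s' t'
      proof -
        from ZP[OF that(1)] that(4) obtain x where I: "I = (x, {s..t})" "(x, {s..t}) \<in> D" by auto
        from ZP[OF that(2)] that(5) obtain x' where J: "J = (x', {s'..t'})" "(x', {s'..t'}) \<in> D" by auto
        have "interior {s..t} \<inter> interior {s'..t'} = {}"
          using tagged_division_ofD(5)[OF D(1) I(2) J(2)] that(3) I J by blast
        then show ?thesis by (simp add: disjnt_def)
      qed
      have inj: "inj_on ends Z"
      proof (rule inj_onI, rule ccontr)
        fix I J assume IJ: "I \<in> Z" "J \<in> Z" "ends I = ends J" "I \<noteq> J"
        from ZP[OF IJ(1)] obtain s t where st: "s < t" "ends I = (s, t)" by auto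
        with dis[OF IJ(1,2,4), of s t s t] IJ have "disjnt {s<..<t} {s<..<t}" by simp
        with st show False by (simp add: disjnt_def)
      qed
      have pack: "interval_packing ({l..u} \<inter> T) (ends ` Z)"
        unfolding interval_packing_iff
      proof (intro conjI allI impI)
        fix s t assume "(s, t) \<in> ends ` Z"
        then obtain I where I: "I \<in> Z" "ends I = (s, t)" by auto
        with ZP[OF I(1)] show "s < t" "{s..t} \<subseteq> {l..u} \<inter> T" by auto
        fix s' t' assume "(s', t') \<in> ends ` Z" and ne: "(s, t) \<noteq> (s', t')"
        then obtain J where J: "J \<in> Z" "ends J = (s', t')" by auto
        with I ne have "I \<noteq> J" by auto
        with dis I J show "disjnt {s<..<t} {s'<..<t'}" by blast
      qed (use fin in simp)
      have "\<bar>\<Sum>I\<in>Z. err I\<bar> \<le> (\<Sum>I\<in>Z. \<bar>f (snd (ends I)) - f (fst (ends I))\<bar>)"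
        by (rule order_trans[OF sum_abs], rule sum_mono)
          (auto simp: Z_def err_def k_def ends_def)
      also have "\<dots> = (\<Sum>(s, t)\<in>ends ` Z. \<bar>f t - f s\<bar>)"
        by (simp add: sum.reindex[OF inj] case_prod_beta)
      also have "\<dots> < e / 2"
      proof (rule ac')
        show "interval_packing {l..u} (ends ` Z)" by (rule interval_packing_mono[OF pack]) auto
        have "total_length (ends ` Z) \<le> measure lebesgue T"
          by (rule total_length_le_measure[OF interval_packing_mono[OF pack] Tm(1)]) auto
        with Tm(2) show "total_length (ends ` Z) < d" by simp
      qed
      finally show ?thesis using Gle unfolding eq by simp
    qed
    show "\<exists>\<gamma>. gauge \<gamma> \<and> (\<forall>D. D tagged_division_of cbox l u \<and> \<gamma> fine D \<longrightarrow>
        norm ((\<Sum>(x, K)\<in>D. measure lborel K *\<^sub>R k x) - (f u - f l)) < e)"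
      by (intro exI[of _ \<gamma>] conjI allI impI gauge, elim conjE, rule fine)
  qed
  then have "(k has_integral (f u - f l)) {l..u}" by simp
  then show ?thesis
    by (rule has_integral_spike[OF N, rotated]) (auto simp: k_def)
qed



section \<open>Exponential weights on a half-line\<close>

lemma has_bochner_integral_exp_tail:
  fixes r y :: real
  assumes r: "0 < r"
  shows "has_bochner_integral lborel (\<lambda>x. indicator {y<..} x * exp (- r * x)) (exp (- r * y) / r)"
proof -
  have "has_bochner_integral lborel
      (\<lambda>x. Re (indicator {0<..} x *\<^sub>R exp (- complex_of_real r * complex_of_real x))) (Re (1 / complex_of_real r))"
    by (rule has_bochner_integral_bounded_linear[OF bounded_linear_Re
          has_bochner_integral_exp_atLeast_0]) (use r in simp)
  also have "(\<lambda>x. Re (indicator {0<..} x *\<^sub>R exp (- complex_of_real r * complex_of_real x))) =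
      (\<lambda>x. indicator {0<..} x * exp (- r * x))"
    by (auto simp: Re_exp)
  finally have "has_bochner_integral lborel (\<lambda>x. exp (- r * y) * (indicator {0<..} x * exp (- r * x)))
      (exp (- r * y) * (1 / r))"
    by (intro has_bochner_integral_mult_right) simp
  then have "has_bochner_integral lborel
      (\<lambda>x. exp (- r * y) * (indicator {0<..} (- y + 1 * x) * exp (- r * (- y + 1 * x)))) (exp (- r * y) * (1 / r))"
    using lborel_has_bochner_integral_real_affine_iff[of 1
        "\<lambda>x. exp (- r * y) * (indicator {0<..} x * exp (- r * x))" "exp (- r * y) * (1 / r)" "- y"]
    by simp
  also have "(\<lambda>x. exp (- r * y) * (indicator {0<..} (- y + 1 * x) * exp (- r * (- y + 1 * x)))) =
      (\<lambda>x. indicator {y<..} x * exp (- r * x))"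
    by (auto simp: indicator_def exp_add[symmetric] algebra_simps)
  finally show ?thesis by simp
qed

text \<open>
  With \<open>K x\<close> written as an integral, the left-hand side is a double integral over \<open>0 < y < x\<close>, and the
  integral over \<open>x\<close> of \<open>exp (- r * x)\<close> from \<open>y\<close> on is \<open>exp (- r * y) / r\<close>. This replaces partial
  integration without a limit at infinity, and it yields the integrability of the left-hand side.
\<close>

lemma exponential_integral_of_primitive:
  fixes k K :: "real \<Rightarrow> real"
  assumes r: "0 < r" and k [measurable]: "k \<in> borel_measurable borel"
    and int: "integrable lborel (\<lambda>y. indicator {0<..} y * (exp (- r * y) * k y))"
    and K: "\<And>x. 0 < x \<Longrightarrow> K x = (\<integral>y. indicator {0<..<x} y * k y \<partial>lborel)"
  shows "has_bochner_integral lborel (\<lambda>x. indicator {0<..} x * (exp (- r * x) * K x))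
    ((\<integral>y. indicator {0<..} y * (exp (- r * y) * k y) \<partial>lborel) / r)"
proof -
  define F where "F = (\<lambda>(y::real, x::real). if 0 < y \<and> y < x then k y * exp (- r * x) else 0)"
  have F: "F (y, x) = indicator {0<..} y * k y * (indicator {y<..} x * exp (- r * x))" for y x
    by (simp add: F_def indicator_def)
  note tail = has_bochner_integral_exp_tail[OF r]
  have inner: "has_bochner_integral lborel (\<lambda>x. F (y, x)) (indicator {0<..} y * (exp (- r * y) * k y) / r)" for y
    using has_bochner_integral_mult_right[OF tail, of "indicator {0<..} y * k y" y] by (simp add: F ac_simps)
  have inner_norm: "has_bochner_integral lborel (\<lambda>x. norm (F (y, x)))
      (norm (indicator {0<..} y * (exp (- r * y) * k y)) / r)" for y
    using has_bochner_integral_mult_right[OF tail, of "\<bar>indicator {0<..} y * k y\<bar>" y]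
    by (simp add: F abs_mult ac_simps)
  have meas: "F \<in> borel_measurable (lborel \<Otimes>\<^sub>M lborel)"
  proof -
    have "F \<in> borel_measurable (borel \<Otimes>\<^sub>M borel)" unfolding F_def by measurable
    then show ?thesis
      by (subst measurable_cong_sets[OF sets_pair_measure_cong[OF sets_lborel sets_lborel] refl])
  qed
  have FI: "integrable (lborel \<Otimes>\<^sub>M lborel) F"
  proof (rule lborel_pair.Fubini_integrable[OF meas])
    have "integrable lborel (\<lambda>y. norm (indicator {0<..} y * (exp (- r * y) * k y)) / r)"
      using int by (intro integrable_divide integrable_norm) auto
    then show "integrable lborel (\<lambda>y. \<integral>x. norm (F (y, x)) \<partial>lborel)"
      using inner_norm by (simp add: has_bochner_integral_iff)
    show "AE y in lborel. integrable lborel (\<lambda>x. F (y, x))"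
      using inner by (simp add: has_bochner_integral_iff)
  qed
  have other: "(\<integral>y. F (y, x) \<partial>lborel) = indicator {0<..} x * (exp (- r * x) * K x)" for x
  proof (cases "0 < x")
    case True
    have "(\<lambda>y. F (y, x)) = (\<lambda>y. exp (- r * x) * (indicator {0<..<x} y * k y))"
      by (auto simp: F indicator_def)
    then show ?thesis using K[OF True] True by simp
  next
    case False
    then have "(\<lambda>y. F (y, x)) = (\<lambda>y. 0)"
      by (auto simp: F indicator_def)
    then show ?thesis using False by simp
  qed
  have FI': "integrable (lborel \<Otimes>\<^sub>M lborel) (\<lambda>(y, x). F (y, x))" using FI by simp
  have "integrable lborel (\<lambda>x. \<integral>y. F (y, x) \<partial>lborel)"
    by (rule lborel_pair.integrable_snd[OF FI'])
  moreover have "(\<integral>x. (\<integral>y. F (y, x) \<partial>lborel) \<partial>lborel) = (\<integral>y. (\<integral>x. F (y, x) \<partial>lborel) \<partial>lborel)"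
    by (rule lborel_pair.Fubini_integral[OF FI'])
  moreover have "(\<integral>x. F (y, x) \<partial>lborel) = indicator {0<..} y * (exp (- r * y) * k y) / r" for y
    using inner by (simp add: has_bochner_integral_iff)
  ultimately show ?thesis
    by (simp add: other has_bochner_integral_iff)
qed

lemma has_bochner_integral_two_sides:
  fixes g :: "real \<Rightarrow> real"
  assumes g [measurable]: "g \<in> borel_measurable borel"
    and R: "has_bochner_integral lborel (\<lambda>x. indicator {0<..} x * g (\<mu> + 1 * x)) A"
    and L: "has_bochner_integral lborel (\<lambda>x. indicator {0<..} x * g (\<mu> + (- 1) * x)) B"
  shows "has_bochner_integral lborel g (A + B)"
proof -
  have R': "has_bochner_integral lborel (\<lambda>z. indicator {0<..} (z - \<mu>) * g z) A"
    using lborel_has_bochner_integral_real_affine_iff[of 1 "\<lambda>z. indicator {0<..} (z - \<mu>) * g z" A \<mu>] R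
    by simp
  have L': "has_bochner_integral lborel (\<lambda>z. indicator {0<..} (\<mu> - z) * g z) B"
    using lborel_has_bochner_integral_real_affine_iff[of "- 1" "\<lambda>z. indicator {0<..} (\<mu> - z) * g z" B \<mu>] L
    by simp
  have "AE z in lborel. indicator {0<..} (z - \<mu>) * g z + indicator {0<..} (\<mu> - z) * g z = g z"
    using AE_lborel_singleton[of \<mu>] by eventually_elim (auto simp: indicator_def)
  then show ?thesis
    by (subst has_bochner_integral_cong_AE[symmetric])
      (use has_bochner_integral_add[OF R' L'] in auto)
qed

section \<open>The Stein identity for the asymmetric Laplace distribution\<close>

text \<open>
  The two half-lines are treated together: \<open>\<sigma> = 1\<close> is the right one and \<open>\<sigma> = - 1\<close> the left one.
\<close>

lemma asymmetric_laplace_density_side: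
  assumes b: "0 < b" and \<sigma>: "\<sigma> \<in> {1, - 1}" and x: "0 < x"
  shows "asymmetric_laplace_density \<mu> a b (\<mu> + \<sigma> * x) =
    exp (- ((sqrt (2 * b\<^sup>2 + a\<^sup>2) - \<sigma> * a) / b\<^sup>2) * x) / sqrt (2 * b\<^sup>2 + a\<^sup>2)"
proof -
  define s where "s = sqrt (2 * b\<^sup>2 + a\<^sup>2)"
  have "1 / b * sqrt (2 + a\<^sup>2 / b\<^sup>2) = 1 / b * sqrt ((2 * b\<^sup>2 + a\<^sup>2) / b\<^sup>2)"
    using b by (simp add: field_simps)
  also have "\<dots> = s / b\<^sup>2"
    using b by (simp add: real_sqrt_divide s_def power2_eq_square)
  finally have rate: "1 / b * sqrt (2 + a\<^sup>2 / b\<^sup>2) = s / b\<^sup>2" .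
  have "\<bar>\<sigma> * x\<bar> = x" using \<sigma> x by auto
  then have "a / b\<^sup>2 * (\<sigma> * x) - s / b\<^sup>2 * \<bar>\<sigma> * x\<bar> = - ((s - \<sigma> * a) / b\<^sup>2) * x"
    using b by (simp add: field_simps)
  then show ?thesis
    unfolding asymmetric_laplace_density_def rate s_def[symmetric] by simp
qed

text \<open>
  Write \<open>I h\<close> for the weighted integral of \<open>h\<close> over the half-line. Applied to \<open>f\<close> and to \<open>g = f'\<close>, the
  formula for primitives expresses the integrals of \<open>f - f \<mu>\<close> and of \<open>k = f''\<close> through \<open>I g\<close> and the boundary value
  \<open>g \<mu>\<close>. The rate \<open>r\<close> is such that \<open>b\<^sup>2 / 2 * (\<sigma> * r) + a - \<sigma> / r = 0\<close>, so the coefficient of \<open>I g\<close> vanishes and only the boundary value remains.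
  The result is odd in \<open>\<sigma>\<close>, which is why the two sides cancel.
\<close>

lemma one_sided_stein_integral:
  fixes f g k :: "real \<Rightarrow> real" and \<sigma> r s :: real
  assumes b: "0 < b" and \<sigma>: "\<sigma> \<in> {1, - 1}"
    and s: "s = sqrt (2 * b\<^sup>2 + a\<^sup>2)" and r: "r = (s - \<sigma> * a) / b\<^sup>2"
    and g [measurable]: "g \<in> borel_measurable borel" and k [measurable]: "k \<in> borel_measurable borel"
    and fg: "\<And>u v. u < v \<Longrightarrow> has_bochner_integral lborel (\<lambda>z. indicator {u<..<v} z * g z) (f v - f u)"
    and gk: "\<And>u v. u < v \<Longrightarrow> has_bochner_integral lborel (\<lambda>z. indicator {u<..<v} z * k z) (g v - g u)"
    and ig: "integrable lborel (\<lambda>x. indicator {0<..} x * (exp (- r * x) * g (\<mu> + \<sigma> * x)))"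
    and ik: "integrable lborel (\<lambda>x. indicator {0<..} x * (exp (- r * x) * k (\<mu> + \<sigma> * x)))"
  shows "has_bochner_integral lborel (\<lambda>x. indicator {0<..} x * (exp (- r * x) *
      (b\<^sup>2 / 2 * k (\<mu> + \<sigma> * x) + a * g (\<mu> + \<sigma> * x) - (f (\<mu> + \<sigma> * x) - f \<mu>)))) (- \<sigma> * (b\<^sup>2 / 2) * g \<mu>)"
proof -
  have s2: "s\<^sup>2 = 2 * b\<^sup>2 + a\<^sup>2" by (simp add: s)
  have \<sigma>\<sigma>: "\<sigma> * \<sigma> = 1" using \<sigma> by auto
  then have \<sigma>2: "\<sigma> * (\<sigma> * z) = z" for z by (simp flip: mult.assoc)
  have "sqrt (a\<^sup>2) < s" unfolding s using b by (intro real_sqrt_less_mono) auto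
  then have "\<bar>a\<bar> < s" by simp
  then have sa: "\<sigma> * a < s" using \<sigma> by auto
  then have r0: "0 < r" using b by (simp add: r)
  have prim: "H (\<mu> + \<sigma> * x) - H \<mu> = (\<integral>y. indicator {0<..<x} y * (\<sigma> * h (\<mu> + \<sigma> * y)) \<partial>lborel)"
    if x: "0 < x" and Hh: "\<And>u v. u < v \<Longrightarrow> has_bochner_integral lborel (\<lambda>z. indicator {u<..<v} z * h z) (H v - H u)"
    for H h :: "real \<Rightarrow> real" and x
  proof -
    have "has_bochner_integral lborel (\<lambda>y. indicator {0<..<x} y * h (\<mu> + \<sigma> * y)) (\<sigma> * (H (\<mu> + \<sigma> * x) - H \<mu>))"
    proof (cases "\<sigma> = 1")
      case True
      have "has_bochner_integral lborel
          (\<lambda>y. indicator {\<mu><..<\<mu> + x} (\<mu> + 1 * y) * h (\<mu> + 1 * y)) (H (\<mu> + x) - H \<mu>)"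
        using lborel_has_bochner_integral_real_affine_iff[THEN iffD1, OF _ Hh[of \<mu> "\<mu> + x"], of 1 \<mu>] x
        by simp
      then show ?thesis using True by (simp add: indicator_def)
    next
      case False
      then have "\<sigma> = - 1" using \<sigma> by simp
      have "has_bochner_integral lborel
          (\<lambda>y. indicator {\<mu> - x<..<\<mu>} (\<mu> + (- 1) * y) * h (\<mu> + (- 1) * y)) (H \<mu> - H (\<mu> - x))"
        using lborel_has_bochner_integral_real_affine_iff[THEN iffD1, OF _ Hh[of "\<mu> - x" \<mu>], of "- 1" \<mu>] x
        by simp
      moreover have "indicator {\<mu> - x<..<\<mu>} (\<mu> + (- 1) * y) = (indicator {0<..<x} y :: real)" for y
        by (auto simp: indicator_def)
      ultimately show ?thesis using \<open>\<sigma> = - 1\<close> by simp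
    qed
    then have "has_bochner_integral lborel (\<lambda>y. \<sigma> * (indicator {0<..<x} y * h (\<mu> + \<sigma> * y)))
        (\<sigma> * (\<sigma> * (H (\<mu> + \<sigma> * x) - H \<mu>)))"
      by (rule has_bochner_integral_mult_right)
    then show ?thesis
      unfolding \<sigma>2 by (simp add: has_bochner_integral_iff mult.left_commute)
  qed
  define I where "I = (\<lambda>h. \<integral>x. indicator {0<..} x * (exp (- r * x) * h (\<mu> + \<sigma> * x)) \<partial>lborel)"
  have step: "has_bochner_integral lborel
      (\<lambda>x. indicator {0<..} x * (exp (- r * x) * (H (\<mu> + \<sigma> * x) - H \<mu>))) (\<sigma> * I h / r)"
    if Hh: "\<And>u v. u < v \<Longrightarrow> has_bochner_integral lborel (\<lambda>z. indicator {u<..<v} z * h z) (H v - H u)"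
      and ih: "integrable lborel (\<lambda>x. indicator {0<..} x * (exp (- r * x) * h (\<mu> + \<sigma> * x)))"
      and h [measurable]: "h \<in> borel_measurable borel"
    for H h :: "real \<Rightarrow> real"
  proof -
    have eq: "indicator {0<..} y * (exp (- r * y) * (\<sigma> * h (\<mu> + \<sigma> * y))) =
      \<sigma> * (indicator {0<..} y * (exp (- r * y) * h (\<mu> + \<sigma> * y)))" for y by simp
    have "has_bochner_integral lborel
        (\<lambda>x. indicator {0<..} x * (exp (- r * x) * (H (\<mu> + \<sigma> * x) - H \<mu>)))
        ((\<integral>y. indicator {0<..} y * (exp (- r * y) * (\<sigma> * h (\<mu> + \<sigma> * y))) \<partial>lborel) / r)"
    proof (rule exponential_integral_of_primitive[OF r0])
      show "integrable lborel (\<lambda>y. indicator {0<..} y * (exp (- r * y) * (\<sigma> * h (\<mu> + \<sigma> * y))))"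
        unfolding eq using ih by (intro integrable_mult_right)
    qed (simp_all add: prim[OF _ Hh])
    then show ?thesis by (simp only: eq I_def integral_mult_right_zero)
  qed
  have Hg: "has_bochner_integral lborel (\<lambda>x. indicator {0<..} x * (exp (- r * x) * g (\<mu> + \<sigma> * x))) (I g)"
    using ig by (simp add: has_bochner_integral_iff I_def)
  have Hk: "has_bochner_integral lborel (\<lambda>x. indicator {0<..} x * (exp (- r * x) * k (\<mu> + \<sigma> * x))) (I k)"
    using ik by (simp add: has_bochner_integral_iff I_def)
  have "has_bochner_integral lborel
      (\<lambda>x. indicator {0<..} x * (exp (- r * x) * (g (\<mu> + \<sigma> * x) - g \<mu>)) +
           g \<mu> * (indicator {0<..} x * exp (- r * x))) (\<sigma> * I k / r + g \<mu> * (exp (- r * 0) / r))"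
    by (intro has_bochner_integral_add has_bochner_integral_mult_right step[OF gk ik k]
        has_bochner_integral_exp_tail r0)
  also have "(\<lambda>x. indicator {0<..} x * (exp (- r * x) * (g (\<mu> + \<sigma> * x) - g \<mu>)) +
      g \<mu> * (indicator {0<..} x * exp (- r * x))) =
      (\<lambda>x. indicator {0<..} x * (exp (- r * x) * g (\<mu> + \<sigma> * x)))"
    by (simp add: fun_eq_iff algebra_simps)
  finally have "I g = \<sigma> * I k / r + g \<mu> * (exp (- r * 0) / r)"
    using Hg by (rule has_bochner_integral_eq[rotated])
  then have "r * I g = \<sigma> * I k + g \<mu>" using r0 by (simp add: field_simps)
  then have "\<sigma> * (r * I g) = \<sigma> * \<sigma> * I k + \<sigma> * g \<mu>" by (simp add: algebra_simps)
  then have Ik: "I k = \<sigma> * r * I g - \<sigma> * g \<mu>" using \<sigma>\<sigma> by simp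
  have "b\<^sup>2 / 2 * (\<sigma> * r) + a - \<sigma> / r = 0"
  proof -
    have "(s - \<sigma> * a) * (s + \<sigma> * a) = s\<^sup>2 - (\<sigma> * \<sigma>) * a\<^sup>2"
      by (simp add: algebra_simps power2_eq_square)
    also have "\<dots> = 2 * b\<^sup>2" by (simp add: \<sigma>\<sigma> s2)
    finally have "1 / r = (s + \<sigma> * a) / 2"
      using b sa r0 unfolding r by (simp add: field_simps)
    then have "\<sigma> / r = \<sigma> * ((s + \<sigma> * a) / 2)" by (metis mult.right_neutral times_divide_eq_right)
    moreover have "b\<^sup>2 / 2 * (\<sigma> * r) = \<sigma> * (s - \<sigma> * a) / 2" using b by (simp add: r)
    ultimately have "b\<^sup>2 / 2 * (\<sigma> * r) + a - \<sigma> / r = \<sigma> * (s - \<sigma> * a) / 2 + a - \<sigma> * ((s + \<sigma> * a) / 2)"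
      by (simp only:)
    also have "\<dots> = a - (\<sigma> * \<sigma>) * a" by (simp add: field_simps)
    finally show ?thesis by (simp add: \<sigma>\<sigma>)
  qed
  then have "b\<^sup>2 / 2 * I k + a * I g - \<sigma> * I g / r = - \<sigma> * (b\<^sup>2 / 2) * g \<mu>"
  proof -
    assume *: "b\<^sup>2 / 2 * (\<sigma> * r) + a - \<sigma> / r = 0"
    have "b\<^sup>2 / 2 * I k + a * I g - \<sigma> * I g / r = (b\<^sup>2 / 2 * (\<sigma> * r) + a - \<sigma> / r) * I g - \<sigma> * (b\<^sup>2 / 2) * g \<mu>"
      by (simp add: Ik algebra_simps)
    then show ?thesis unfolding * by simp
  qed
  moreover have "has_bochner_integral lborel
      (\<lambda>x. b\<^sup>2 / 2 * (indicator {0<..} x * (exp (- r * x) * k (\<mu> + \<sigma> * x))) +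
        a * (indicator {0<..} x * (exp (- r * x) * g (\<mu> + \<sigma> * x))) -
        indicator {0<..} x * (exp (- r * x) * (f (\<mu> + \<sigma> * x) - f \<mu>)))
      (b\<^sup>2 / 2 * I k + a * I g - \<sigma> * I g / r)"
    by (intro has_bochner_integral_diff has_bochner_integral_add has_bochner_integral_mult_right Hg Hk
        step[OF fg ig g])
  moreover have "(\<lambda>x. b\<^sup>2 / 2 * (indicator {0<..} x * (exp (- r * x) * k (\<mu> + \<sigma> * x))) +
        a * (indicator {0<..} x * (exp (- r * x) * g (\<mu> + \<sigma> * x))) -
        indicator {0<..} x * (exp (- r * x) * (f (\<mu> + \<sigma> * x) - f \<mu>))) =
      (\<lambda>x. indicator {0<..} x * (exp (- r * x) *
        (b\<^sup>2 / 2 * k (\<mu> + \<sigma> * x) + a * g (\<mu> + \<sigma> * x) - (f (\<mu> + \<sigma> * x) - f \<mu>))))"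
    by (simp add: fun_eq_iff algebra_simps)
  ultimately show ?thesis by simp
qed


text \<open>
  The density is bounded away from 0 on compact intervals, so integrability against the distribution
  gives local Lebesgue integrability, and there the two notions of integral agree.
\<close>

lemma locally_abs_continuous_FTC_lborel:
  assumes ac: "locally_abs_continuous g" and b: "0 < b"
    and int: "integrable (asymmetric_laplace \<mu> a b) (deriv g)"
    and uv: "u < v"
  shows "has_bochner_integral lborel (\<lambda>z. indicator {u<..<v} z * deriv g z) (g v - g u)"
proof -
  define \<rho> where "\<rho> = asymmetric_laplace_density \<mu> a b"
  have [measurable]: "deriv g \<in> borel_measurable borel"
    using borel_measurable_integrable[OF int] by (simp add: asymmetric_laplace_def)
  have \<rho>: "integrable lborel (\<lambda>z. \<rho> z * deriv g z)"
    using int unfolding asymmetric_laplace_def \<rho>_def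
    by (simp add: integrable_density asymmetric_laplace_density_nonneg)
  have "continuous_on {u..v} \<rho>"
    unfolding \<rho>_def asymmetric_laplace_density_def by (intro continuous_intros)
  then obtain w where w: "\<forall>z\<in>{u..v}. \<rho> w \<le> \<rho> z"
    using continuous_attains_inf[of "{u..v}" \<rho>] uv by auto
  have "0 < 2 * b\<^sup>2 + a\<^sup>2" using b by (simp add: add_pos_nonneg)
  then have w0: "0 < \<rho> w" by (simp add: \<rho>_def asymmetric_laplace_density_def)
  have "integrable lborel (\<lambda>z. indicator {u<..<v} z * deriv g z)"
  proof (rule Bochner_Integration.integrable_bound)
    show "integrable lborel (\<lambda>z. (1 / \<rho> w) * (\<rho> z * deriv g z))"
      using \<rho> by (rule integrable_mult_right)
    show "AE z in lborel. norm (indicator {u<..<v} z * deriv g z) \<le> norm ((1 / \<rho> w) * (\<rho> z * deriv g z))"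
    proof (rule AE_I2)
      fix z
      show "norm (indicator {u<..<v} z * deriv g z) \<le> norm ((1 / \<rho> w) * (\<rho> z * deriv g z))"
      proof (cases "z \<in> {u<..<v}")
        case True
        then have "1 \<le> \<rho> z / \<rho> w" using w w0 by simp
        then have "1 * \<bar>deriv g z\<bar> \<le> (\<rho> z / \<rho> w) * \<bar>deriv g z\<bar>" by (rule mult_right_mono) simp
        moreover have "0 \<le> \<rho> z" by (simp add: \<rho>_def asymmetric_laplace_density_nonneg)
        ultimately show ?thesis using True w0 by (simp add: abs_mult)
      qed simp
    qed
  qed simp
  then have si: "set_integrable lborel {u<..<v} (deriv g)" by (simp add: set_integrable_def)
  have "(deriv g has_integral (g v - g u)) {u..v}"
    using ac uv by (intro abs_continuous_on_FTC) (auto simp: locally_abs_continuous_def)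
  then have "integral {u<..<v} (deriv g) = g v - g u"
    by (simp add: integral_unique flip: integral_open_interval_real)
  with set_borel_integral_eq_integral(2)[OF si] si show ?thesis
    by (simp add: has_bochner_integral_iff set_integrable_def set_lebesgue_integral_def)
qed

lemma has_bochner_integral_stein_asymmetric_laplace:
  assumes b: "0 < b" and diff: "\<And>x. f field_differentiable (at x)"
    and ac: "locally_abs_continuous f" "locally_abs_continuous (deriv f)"
    and int: "integrable (asymmetric_laplace \<mu> a b) (deriv f)"
      "integrable (asymmetric_laplace \<mu> a b) (deriv (deriv f))"
  shows "has_bochner_integral (asymmetric_laplace \<mu> a b)
    (\<lambda>x. b\<^sup>2 / 2 * deriv (deriv f) x + a * deriv f x - (f x - f \<mu>)) 0"
proof -
  define \<rho> where "\<rho> = asymmetric_laplace_density \<mu> a b"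
  define s where "s = sqrt (2 * b\<^sup>2 + a\<^sup>2)"
  define r where "r = (\<lambda>\<sigma>. (s - \<sigma> * a) / b\<^sup>2)"
  define S where "S = (\<lambda>x. b\<^sup>2 / 2 * deriv (deriv f) x + a * deriv f x - (f x - f \<mu>))"
  have "0 < 2 * b\<^sup>2 + a\<^sup>2" using b by (simp add: add_pos_nonneg)
  then have s0: "0 < s" by (simp add: s_def)
  have [measurable]: "deriv f \<in> borel_measurable borel" "deriv (deriv f) \<in> borel_measurable borel"
    using int[THEN borel_measurable_integrable] by (simp_all add: asymmetric_laplace_def)
  have [measurable]: "f \<in> borel_measurable borel"
    by (intro borel_measurable_continuous_onI continuous_at_imp_continuous_on ballI
        field_differentiable_imp_continuous_at diff)
  have [measurable]: "S \<in> borel_measurable borel" unfolding S_def by measurable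
  have side: "indicator {0<..} x * (\<rho> (\<mu> + \<sigma> * x) * h (\<mu> + \<sigma> * x)) =
      (1 / s) * (indicator {0<..} x * (exp (- r \<sigma> * x) * h (\<mu> + \<sigma> * x)))"
    if "\<sigma> \<in> {1, - 1}" for \<sigma> x and h :: "real \<Rightarrow> real"
    using asymmetric_laplace_density_side[OF b that, of x \<mu> a]
    by (simp add: indicator_def \<rho>_def r_def s_def)
  have integ: "integrable lborel (\<lambda>x. indicator {0<..} x * (exp (- r \<sigma> * x) * h (\<mu> + \<sigma> * x)))"
    if \<sigma>: "\<sigma> \<in> {1, - 1}" and h [measurable]: "h \<in> borel_measurable borel"
      and ih: "integrable (asymmetric_laplace \<mu> a b) h" for \<sigma> and h :: "real \<Rightarrow> real"
  proof -
    have "integrable lborel (\<lambda>z. \<rho> z * h z)"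
      using ih unfolding asymmetric_laplace_def \<rho>_def
      by (simp add: integrable_density asymmetric_laplace_density_nonneg)
    then have "integrable lborel (\<lambda>x. \<rho> (\<mu> + \<sigma> * x) * h (\<mu> + \<sigma> * x))"
      using lborel_integrable_real_affine[of "\<lambda>z. \<rho> z * h z" \<sigma> \<mu>] \<sigma> by auto
    then have "integrable lborel (\<lambda>x. indicator {0<..} x * (\<rho> (\<mu> + \<sigma> * x) * h (\<mu> + \<sigma> * x)))"
      using integrable_mult_indicator[of "{0<..}" lborel "\<lambda>x. \<rho> (\<mu> + \<sigma> * x) * h (\<mu> + \<sigma> * x)"] by simp
    then have "integrable lborel (\<lambda>x. s * ((1 / s) * (indicator {0<..} x * (exp (- r \<sigma> * x) * h (\<mu> + \<sigma> * x)))))"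
      unfolding side[OF \<sigma>] by (rule integrable_mult_right)
    then show ?thesis using s0 by simp
  qed
  have one: "has_bochner_integral lborel
      (\<lambda>x. indicator {0<..} x * (\<rho> (\<mu> + \<sigma> * x) * S (\<mu> + \<sigma> * x)))
      ((1 / s) * (- \<sigma> * (b\<^sup>2 / 2) * deriv f \<mu>))"
    if \<sigma>: "\<sigma> \<in> {1, - 1}" for \<sigma>
    unfolding side[OF \<sigma>, where h = S] unfolding S_def
  proof (intro has_bochner_integral_mult_right one_sided_stein_integral[OF b \<sigma> s_def, where r = "r \<sigma>"])
    show "r \<sigma> = (s - \<sigma> * a) / b\<^sup>2" by (simp add: r_def)
  qed (use locally_abs_continuous_FTC_lborel[OF ac(1) b int(1)]
      locally_abs_continuous_FTC_lborel[OF ac(2) b int(2)] integ[OF \<sigma>] int in auto)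
  have "has_bochner_integral lborel (\<lambda>x. \<rho> x * S x)
      ((1 / s) * (- 1 * (b\<^sup>2 / 2) * deriv f \<mu>) + (1 / s) * (- (- 1) * (b\<^sup>2 / 2) * deriv f \<mu>))"
  proof (rule has_bochner_integral_two_sides)
    show "(\<lambda>x. \<rho> x * S x) \<in> borel_measurable borel" unfolding \<rho>_def by measurable
  qed (rule one, simp)+
  then have "has_bochner_integral lborel (\<lambda>x. \<rho> x *\<^sub>R S x) 0" by simp
  then show ?thesis
    unfolding asymmetric_laplace_def \<rho>_def S_def[symmetric]
    by (intro has_bochner_integral_density) (auto simp: asymmetric_laplace_density_nonneg)
qed

section \<open>Characterization by the Stein identity\<close>

lemma Lipschitz_imp_locally_abs_continuous:
  assumes L: "\<And>x y. \<bar>f y - f x\<bar> \<le> L * \<bar>y - x\<bar>"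
  shows "locally_abs_continuous f"
  unfolding locally_abs_continuous_def abs_continuous_on_def
proof (intro allI impI)
  fix l u e :: real assume e: "0 < e"
  show "\<exists>d>0. \<forall>P. finite P \<longrightarrow> (\<forall>(s, t)\<in>P. s < t \<and> {s..t} \<subseteq> {l..u}) \<longrightarrow>
      pairwise (\<lambda>(s, t) (s', t'). disjnt {s<..<t} {s'<..<t'}) P \<longrightarrow>
      (\<Sum>(s, t)\<in>P. t - s) < d \<longrightarrow> (\<Sum>(s, t)\<in>P. \<bar>f t - f s\<bar>) < e"
  proof (intro exI[of _ "e / (\<bar>L\<bar> + 1)"] conjI allI impI)
    fix P :: "(real \<times> real) set"
    assume P: "\<forall>(s, t)\<in>P. s < t \<and> {s..t} \<subseteq> {l..u}" and len: "(\<Sum>(s, t)\<in>P. t - s) < e / (\<bar>L\<bar> + 1)"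
    have "(\<Sum>(s, t)\<in>P. \<bar>f t - f s\<bar>) \<le> (\<Sum>(s, t)\<in>P. (\<bar>L\<bar> + 1) * (t - s))"
    proof (intro sum_mono, clarify)
      fix s t assume "(s, t) \<in> P"
      then have "s < t" using P by auto
      then have "L * \<bar>t - s\<bar> \<le> (\<bar>L\<bar> + 1) * (t - s)" by (auto intro!: mult_right_mono)
      with L show "\<bar>f t - f s\<bar> \<le> (\<bar>L\<bar> + 1) * (t - s)" by (rule order_trans)
    qed
    also have "\<dots> = (\<bar>L\<bar> + 1) * (\<Sum>(s, t)\<in>P. t - s)"
      by (simp add: sum_distrib_left case_prod_beta)
    also have "\<dots> < e"
      using len by (simp add: pos_less_divide_eq mult.commute)
    finally show "(\<Sum>(s, t)\<in>P. \<bar>f t - f s\<bar>) < e" .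
  qed (use e in simp)
qed

lemma bounded_deriv_imp_locally_abs_continuous:
  fixes f :: "real \<Rightarrow> real"
  assumes d: "\<And>x. (f has_field_derivative f' x) (at x)" and bd: "\<And>x. \<bar>f' x\<bar> \<le> L"
  shows "locally_abs_continuous f"
proof (rule Lipschitz_imp_locally_abs_continuous)
  show "\<bar>f y - f x\<bar> \<le> L * \<bar>y - x\<bar>" for x y
    using field_differentiable_bound[of UNIV f f' L y x] d bd by simp
qed

text \<open>
  In the backward direction, \<open>c\<close> and \<open>s\<close> are the real and imaginary part of the characteristic function at
  \<open>t\<close>. The equations \<open>C\<close> and \<open>S\<close> together say that it becomes \<open>iexp (\<mu> * t)\<close> after
  multiplication by \<open>1 + b\<^sup>2 * t\<^sup>2 / 2 - \<i> * a * t\<close>, which is never zero.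
\<close>

theorem lemma2p1:
  fixes \<mu> a b :: real and M :: "'w measure" and W :: "'w \<Rightarrow> real"
  assumes "b > 0" and "prob_space M" and "W \<in> borel_measurable M"
  shows "distr M borel W = asymmetric_laplace \<mu> a b \<longleftrightarrow>
    (\<forall>f :: real \<Rightarrow> real.
       (\<forall>x. f field_differentiable (at x)) \<longrightarrow>
       locally_abs_continuous f \<longrightarrow> locally_abs_continuous (deriv f) \<longrightarrow>
       integrable (asymmetric_laplace \<mu> a b) (deriv f) \<longrightarrow>
       integrable (asymmetric_laplace \<mu> a b) (deriv (deriv f)) \<longrightarrow>
       has_bochner_integral M
         (\<lambda>\<omega>. b\<^sup>2 / 2 * deriv (deriv f) (W \<omega>) + a * deriv f (W \<omega>) - (f (W \<omega>) - f \<mu>)) 0)"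
    (is "?law \<longleftrightarrow> ?stein")
proof
  assume law: ?law
  show ?stein
  proof (intro allI impI)
    fix f :: "real \<Rightarrow> real"
    assume f: "\<forall>x. f field_differentiable (at x)" "locally_abs_continuous f"
      "locally_abs_continuous (deriv f)" "integrable (asymmetric_laplace \<mu> a b) (deriv f)"
      "integrable (asymmetric_laplace \<mu> a b) (deriv (deriv f))"
    define S where "S = (\<lambda>x. b\<^sup>2 / 2 * deriv (deriv f) x + a * deriv f x - (f x - f \<mu>))"
    have S: "has_bochner_integral (distr M borel W) S 0"
      unfolding law S_def using f by (intro has_bochner_integral_stein_asymmetric_laplace assms(1)) auto
    then have "S \<in> borel_measurable borel" by (auto dest: borel_measurable_has_bochner_integral)
    with S assms(3) have "has_bochner_integral M (\<lambda>\<omega>. S (W \<omega>)) 0"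
      by (simp add: has_bochner_integral_iff integrable_distr_eq integral_distr)
    then show "has_bochner_integral M
        (\<lambda>\<omega>. b\<^sup>2 / 2 * deriv (deriv f) (W \<omega>) + a * deriv f (W \<omega>) - (f (W \<omega>) - f \<mu>)) 0"
      by (simp add: S_def)
  qed
next
  assume stein: ?stein
  interpret M: prob_space M by fact
  interpret AL: real_distribution "asymmetric_laplace \<mu> a b"
    by (rule real_distribution_asymmetric_laplace[OF assms(1)])
  have W [measurable]: "W \<in> borel_measurable M" by fact
  have trig: "integrable M (\<lambda>\<omega>. cos (t * W \<omega>))" "integrable M (\<lambda>\<omega>. sin (t * W \<omega>))" for t
    by (rule M.integrable_const_bound[of _ 1]; simp)+
  have "char (distr M borel W) t = char (asymmetric_laplace \<mu> a b) t" for t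
  proof -
    have dcos: "((\<lambda>x. cos (t * x)) has_field_derivative - t * sin (t * x)) (at x)"
      and dsin: "((\<lambda>x. sin (t * x)) has_field_derivative t * cos (t * x)) (at x)"
      and dcos': "((\<lambda>x. - t * sin (t * x)) has_field_derivative - t\<^sup>2 * cos (t * x)) (at x)"
      and dsin': "((\<lambda>x. t * cos (t * x)) has_field_derivative - t\<^sup>2 * sin (t * x)) (at x)" for x
      by (auto intro!: derivative_eq_intros simp: power2_eq_square)
    have stein_test: "has_bochner_integral M
         (\<lambda>\<omega>. b\<^sup>2 / 2 * f2 (W \<omega>) + a * f1 (W \<omega>) - (f0 (W \<omega>) - f0 \<mu>)) 0"
      if d: "\<And>x. (f0 has_field_derivative f1 x) (at x)" "\<And>x. (f1 has_field_derivative f2 x) (at x)"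
        and bd: "\<And>x. \<bar>f1 x\<bar> \<le> L" "\<And>x. \<bar>f2 x\<bar> \<le> L" and [measurable]: "f2 \<in> borel_measurable borel"
      for f0 f1 f2 :: "real \<Rightarrow> real" and L
    proof -
      have deq: "deriv f0 = f1" "deriv f1 = f2" using d by (auto intro!: DERIV_imp_deriv)
      have [measurable]: "f1 \<in> borel_measurable borel"
        using d(2) by (intro borel_measurable_continuous_onI) (auto intro!: DERIV_continuous_on)
      have "integrable (asymmetric_laplace \<mu> a b) f1" "integrable (asymmetric_laplace \<mu> a b) f2"
        by (rule AL.integrable_const_bound[of _ L], use bd in auto)+
      moreover have "locally_abs_continuous f0" "locally_abs_continuous f1"
        by (rule bounded_deriv_imp_locally_abs_continuous[OF d(1) bd(1)],
            rule bounded_deriv_imp_locally_abs_continuous[OF d(2) bd(2)])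
      ultimately show ?thesis
        using stein[rule_format, of f0] d(1) by (auto simp: deq field_differentiable_def)
    qed
    define c s where "c = (\<integral>\<omega>. cos (t * W \<omega>) \<partial>M)" and "s = (\<integral>\<omega>. sin (t * W \<omega>) \<partial>M)"
    have bounds: "\<bar>- t * sin (t * x)\<bar> \<le> \<bar>t\<bar> + t\<^sup>2" "\<bar>t * cos (t * x)\<bar> \<le> \<bar>t\<bar> + t\<^sup>2"
      "\<bar>- t\<^sup>2 * sin (t * x)\<bar> \<le> \<bar>t\<bar> + t\<^sup>2" "\<bar>- t\<^sup>2 * cos (t * x)\<bar> \<le> \<bar>t\<bar> + t\<^sup>2" for x
    proof -
      have "\<bar>t\<bar> * \<bar>sin (t * x)\<bar> \<le> \<bar>t\<bar> * 1" "\<bar>t\<bar> * \<bar>cos (t * x)\<bar> \<le> \<bar>t\<bar> * 1"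
        "t\<^sup>2 * \<bar>sin (t * x)\<bar> \<le> t\<^sup>2 * 1" "t\<^sup>2 * \<bar>cos (t * x)\<bar> \<le> t\<^sup>2 * 1"
        by (intro mult_left_mono; simp)+
      moreover have "0 \<le> \<bar>t\<bar>" "0 \<le> t\<^sup>2" by simp_all
      ultimately show "\<bar>- t * sin (t * x)\<bar> \<le> \<bar>t\<bar> + t\<^sup>2" "\<bar>t * cos (t * x)\<bar> \<le> \<bar>t\<bar> + t\<^sup>2"
        "\<bar>- t\<^sup>2 * sin (t * x)\<bar> \<le> \<bar>t\<bar> + t\<^sup>2" "\<bar>- t\<^sup>2 * cos (t * x)\<bar> \<le> \<bar>t\<bar> + t\<^sup>2"
        unfolding abs_mult abs_minus_cancel abs_power2 by linarith+
    qed
    have "0 = (\<integral>\<omega>. b\<^sup>2 / 2 * (- t\<^sup>2 * cos (t * W \<omega>)) + a * (- t * sin (t * W \<omega>)) - (cos (t * W \<omega>) - cos (t * \<mu>)) \<partial>M)"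
      using stein_test[OF dcos dcos' bounds(1,4)] by (simp add: has_bochner_integral_iff)
    also have "\<dots> = b\<^sup>2 / 2 * (- t\<^sup>2 * c) + a * (- t * s) - (c - cos (t * \<mu>))"
      using trig[of t] by (simp add: c_def s_def M.prob_space)
    finally have C: "(1 + b\<^sup>2 * t\<^sup>2 / 2) * c + a * t * s = cos (t * \<mu>)" by (simp add: algebra_simps)
    have "0 = (\<integral>\<omega>. b\<^sup>2 / 2 * (- t\<^sup>2 * sin (t * W \<omega>)) + a * (t * cos (t * W \<omega>)) - (sin (t * W \<omega>) - sin (t * \<mu>)) \<partial>M)"
      using stein_test[OF dsin dsin' bounds(2,3)] by (simp add: has_bochner_integral_iff)
    also have "\<dots> = b\<^sup>2 / 2 * (- t\<^sup>2 * s) + a * (t * c) - (s - sin (t * \<mu>))"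
      using trig[of t] by (simp add: c_def s_def M.prob_space)
    finally have S: "(1 + b\<^sup>2 * t\<^sup>2 / 2) * s - a * t * c = sin (t * \<mu>)" by (simp add: algebra_simps)
    have "char (distr M borel W) t = (\<integral>\<omega>. iexp (t * W \<omega>) \<partial>M)"
      unfolding char_def by (rule integral_distr) auto
    also have "\<dots> = Complex c s"
    proof (rule complex_eqI)
      have int: "integrable M (\<lambda>\<omega>. iexp (t * W \<omega>))"
        by (rule M.integrable_const_bound[of _ 1]) auto
      show "Re (\<integral>\<omega>. iexp (t * W \<omega>) \<partial>M) = Re (Complex c s)"
        using integral_Re[OF int] by (simp add: c_def Re_exp)
      show "Im (\<integral>\<omega>. iexp (t * W \<omega>) \<partial>M) = Im (Complex c s)"
        using integral_Im[OF int] by (simp add: s_def Im_exp)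
    qed
    finally have "char (distr M borel W) t = Complex c s" .
    moreover have "Complex c s = iexp (\<mu> * t) / Complex (1 + b\<^sup>2 * t\<^sup>2 / 2) (- a * t)"
    proof -
      have "0 < 1 + b\<^sup>2 * t\<^sup>2 / 2" by (simp add: add_pos_nonneg)
      then have "Complex (1 + b\<^sup>2 * t\<^sup>2 / 2) (- a * t) \<noteq> 0" by (simp add: complex_eq_iff)
      moreover have "Complex c s * Complex (1 + b\<^sup>2 * t\<^sup>2 / 2) (- a * t) = iexp (\<mu> * t)"
        using C S by (simp add: complex_eq_iff Re_exp Im_exp algebra_simps)
      ultimately show ?thesis by (simp add: eq_divide_eq)
    qed
    moreover have "Complex (1 + b\<^sup>2 * t\<^sup>2 / 2) (- a * t) = 1 + b\<^sup>2 * t\<^sup>2 / 2 - \<i> * a * t"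
      by (simp add: complex_eq_iff flip: of_real_power of_real_mult)
    ultimately show ?thesis by (simp add: char_asymmetric_laplace[OF assms(1)])
  qed
  then show ?law
    by (intro Levy_uniqueness M.real_distribution_distr W AL.real_distribution_axioms ext)
qed

end
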